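(* Let $\mathbb{F}$ have characteristic $0$ and let $\xi\in\mathbb{F}^\times$ be a primitive $e$-th root of unity, $e\ge2$. For $\lambda\in\mathcal{RP}_d$ let $A(\lambda)$ be the Lascoux–Leclerc–Thibon first approximation to the canonical basis element $G(\lambda)$ of $V(\Lambda_0)\subset\mathfrak{F}$, and write $$r_\lambda A(\lambda)=\sum_{\nu\in\mathcal{RP}_d}b_{\lambda,\nu}\,G(\nu)$$ with coefficients $b_{\lambda,\nu}$. Then $b_{\lambda,\nu}=m_\lambda(D(\nu))$ for all $\lambda,\nu\in\mathcal{RP}_d$, i.e. $b_{\lambda,\nu}$ is the graded multiplicity of the ladder weight $\boldsymbol{j}^\lambda$ in the irreducible graded $H_d$-module $D(\nu)$.
   Context: $\mathbb{F}$ is an algebraically closed field. Put $I=\mathbb{Z}/e\mathbb{Z}$. $[n]_q=(q^n-q^{-n})/(q-q^{-1})$, $[n]_q^!=[n]_q\cdots[1]_q$. Combinatorics. $\mathcal{P}_d$ is the set of partitions of $d$, identified with Young diagrams whose nodes are pairs $(a,b)$ (row, column). $\lambda$ is $e$-restricted if $\lambda_r-\lambda_{r+1}<e$ for all $r$; $\mathcal{RP}_d$ is the set of $e$-restricted partitions of $d$. The residue of $(a,b)$ is $\mathrm{res}(a,b)=b-a\bmod e$; an $i$-node is a node of residue $i$. A node is below another if it lies in a row of larger index. A node $A\in\lambda$ is removable if $\lambda\setminus\{A\}$ is a partition; $B\notin\lambda$ is addable if $\lambda\cup\{B\}$ is a partition. For a removable $i$-node $A$ of $\lambda$, $d_A(\lambda)$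 is the number of addable $i$-nodes of $\lambda$ below $A$ minus the number of removable $i$-nodes of $\lambda$ below $A$. $\mathscr{T}(\lambda)$ is the set of standard $\lambda$-tableaux. For $T\in\mathscr{T}(\lambda)$ with $d$ in node $A$, $\deg(T)=d_A(\lambda)+\deg(T_{\le d-1})$ where $T_{\le d-1}$ is $T$ with the node labelled $d$ deleted, and $\deg=0$ when $d=0$. The residue sequence is $\boldsymbol{i}^T=(i_1,\dots,i_d)\in I^d$, $i_r$ the residue of the node labelled $r$. Ladder weight. For $m\ge1$ the ladder $L_m$ (a set of nodes) consists of the nodes $(1+k,m-k(e-1))$, $k\in\mathbb{Z}_{\ge0}$, $k<m/(e-1)$; all its nodes have residue $\mathrm{res}\,L_m=m-1\bmod e$. For $\lambda\in\mathcal{RP}_d$ put $r_m=|\lambda\cap L_m|$, let $t$ be maximal with $r_t\ne0$, and $r_\lambda=[r_1]_q^!\cdots[r_t]_q^!$. For non-empty $\lambda$ the bottom removable sequence $(A_1,\dots,A_r)$ consists of all nodes of $\lambda\cap L_t$ (they are removable), ordered so that $A_u$ is below $A_s$ for $u<s$. The ladder weight $\boldsymbol{j}^\lambda=(j_1,\dots,j_d)\in I^d$ is defined inductively by $j_d=\mathrm{res}\,A_r$ and $(j_1,\dots,j_{d-1})=\boldsymbol{j}^{\lambda\setminus\{A_r\}}$ (empty sequence if $d=0$). For a finite-dimensional graded $H_d$-module $V$, $m_\lambda(V)$ is the coefficient of $\boldsymbol{j}^\lambda$ in $\mathrm{ch}_q V$. Representation theory. $H_d$ is the $\mathbb{F}$-algebra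 with generators $T_1,\dots,T_{d-1}$ and relations $T_r^2=(\xi-1)T_r+\xi$, $T_rT_{r+1}T_r=T_{r+1}T_rT_{r+1}$, $T_rT_s=T_sT_r$ for $|r-s|>1$. Its Jucys–Murphy elements are $X_r=\xi^{1-r}T_{r-1}\cdots T_1T_1\cdots T_{r-1}$ ($1\le r\le d$). For a finite-dimensional module $V$ and $\boldsymbol{i}\in I^d$, $V_{\boldsymbol{i}}=\{v\in V: (X_r-\xi^{i_r})^Nv=0 \text{ for } N\gg0,\ 1\le r\le d\}$. $H_d$ is $\mathbb{Z}$-graded by the Brundan–Kleshchev grading (from its isomorphism with the level one cyclotomic Khovanov–Lauda–Rouquier (KLR) algebra of weight $\Lambda_0$). For a finite-dimensional graded module $V$, $\mathrm{ch}_q V=\sum_{\boldsymbol{i}\in I^d}(\mathrm{qdim}\,V_{\boldsymbol{i}})\,\boldsymbol{i}$ in the free $\mathbb{Z}[q,q^{-1}]$-module on $I^d$, where $\mathrm{qdim}\,W=\sum_m(\dim W_m)q^m$; $V\langle m\rangle$ is the grading shift with $\mathrm{ch}_q V\langle m\rangle=q^m\mathrm{ch}_q V$. $S(\mu)$, $\mu\in\mathcal{P}_d$, is the Dipper–James–Mathas Specht module with the Brundan–Kleshchev–Wang grading; its graded character is known to be $\mathrm{ch}_q S(\mu)=\sum_{T\in\mathscr{T}(\mu)}q^{\deg(T)}\boldsymbol{i}^T$. For $\mu\in\mathcal{RP}_d$ the head $D(\mu)$ of $S(\mu)$ is irreducible, and $\{D(\mu):\mu\in\mathcal{RP}_d\}$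 is a complete irredundant set of irreducible $H_d$-modules. $D(\mu)$ is graded in the unique way making it graded self-dual ($D(\mu)^\circledast\cong D(\mu)$, where $V^\circledast$ is the graded linear dual with action twisted by the antiautomorphism of $H_d$ fixing the KLR generators), and $S(\mu)\twoheadrightarrow D(\mu)$ is then homogeneous of degree zero. The graded decomposition number is $d_{\mu,\nu}=\sum_m a_mq^m$, where $a_m$ is the multiplicity of $D(\nu)\langle m\rangle$ in a graded composition series of $S(\mu)$. Fock space. $\mathfrak{F}$ is the $\mathbb{Q}(q)$-vector space with basis $\bigsqcup_{d\ge0}\mathcal{P}_d$, a $U_q(\widehat{\mathfrak{sl}}_e)$-module on which the lowering operators act by $f_i\mu=\sum_B q^{d_B(\mu\cup\{B\})}(\mu\cup\{B\})$, the sum over addable $i$-nodes $B$ of $\mu$; $f_i^{(r)}=f_i^r/[r]_q^!$. $V(\Lambda_0)$ is the submodule generated by $\varnothing$. With $i_m=\mathrm{res}\,L_m$, $A(\lambda)=f_{i_t}^{(r_t)}\cdots f_{i_1}^{(r_1)}\varnothing$. The bar-involution on $V(\Lambda_0)$ is the $\mathbb{Q}$-linear map sending $q$ to $q^{-1}$, fixing $\varnothing$ and commuting with all $f_i$. $G(\lambda)$ is the unique bar-invariant element of the $\mathbb{Z}[q,q^{-1}]$-span of all products of divided powers $f_i^{(r)}$ applied to $\varnothing$ such that $G(\lambda)-\lambda\in\bigoplus_\mu q\mathbb{Z}[q]\mu$; the $G(\lambda)$, $\lambda$ $e$-restricted, form a basis of $V(\Lambda_0)$. It is known (graded version of Ariki's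 theorem) that $G(\lambda)=\sum_{\mu\in\mathcal{P}_d}d_{\mu,\lambda}\,\mu$. *)

theory Defs
  imports
    "HOL-Library.Poly_Mapping"
    "HOL-Computational_Algebra.Computational_Algebra"
    "HOL-Combinatorics.Permutations"
begin

section \<open>Young diagrams, tableaux, degrees\<close>

text \<open>
  A partition is represented by its Young diagram, a finite set of nodes (row, column)
  with both coordinates starting at 1.  Residues in \<open>I = \<int>/e\<int>\<close> are represented by
  the natural numbers below \<open>e\<close>.
\<close>

type_synonym node = "nat \<times> nat"
type_synonym diagram = "node set"

definition is_diagram :: "diagram \<Rightarrow> bool" where
  "is_diagram \<mu> \<longleftrightarrow> finite \<mu> \<and>
     (\<forall>(a, b)\<in>\<mu>. 1 \<le> a \<and> 1 \<le> b \<and> (\<forall>a'\<in>{1..a}. \<forall>b'\<in>{1..b}. (a', b') \<in> \<mu>))"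

definition partitions_of :: "nat \<Rightarrow> diagram set" where
  "partitions_of d = {\<mu>. is_diagram \<mu> \<and> card \<mu> = d}"

definition row_len :: "diagram \<Rightarrow> nat \<Rightarrow> nat" where
  "row_len \<mu> r = card {b. (r, b) \<in> \<mu>}"

definition restricted_partitions_of :: "nat \<Rightarrow> nat \<Rightarrow> diagram set" where
  "restricted_partitions_of e d =
     {\<mu> \<in> partitions_of d. \<forall>r\<ge>1. row_len \<mu> r - row_len \<mu> (r + 1) < e}"

definition strictly_dominates :: "diagram \<Rightarrow> diagram \<Rightarrow> bool" where
  "strictly_dominates \<nu> \<mu> \<longleftrightarrow> \<nu> \<noteq> \<mu> \<and> (\<forall>k. (\<Sum>r=1..k. row_len \<mu> r) \<le> (\<Sum>r=1..k. row_len \<nu> r))"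

definition res :: "nat \<Rightarrow> node \<Rightarrow> nat" where
  "res e A = nat ((int (snd A) - int (fst A)) mod int e)"

definition removable :: "diagram \<Rightarrow> node \<Rightarrow> bool" where
  "removable \<mu> A \<longleftrightarrow> A \<in> \<mu> \<and> is_diagram (\<mu> - {A})"

definition addable :: "diagram \<Rightarrow> node \<Rightarrow> bool" where
  "addable \<mu> B \<longleftrightarrow> B \<notin> \<mu> \<and> is_diagram (insert B \<mu>)"

definition node_deg :: "nat \<Rightarrow> node \<Rightarrow> diagram \<Rightarrow> int" where
  "node_deg e A \<mu> =
     int (card {B. addable \<mu> B \<and> res e B = res e A \<and> fst A < fst B}) -
     int (card {B. removable \<mu> B \<and> res e B = res e A \<and> fst A < fst B})"

text \<open>
  A tableau is the list of its nodes in the order of their labels: the node labelled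
  \<open>r\<close> is \<open>ts ! (r - 1)\<close>, and \<open>T\<^bsub>\<le>k\<^esub>\<close> is \<open>take k ts\<close>.
\<close>

type_synonym tableau = "node list"

definition standard_tableaux :: "diagram \<Rightarrow> tableau set" where
  "standard_tableaux \<mu> = {ts. distinct ts \<and> set ts = \<mu> \<and>
     (\<forall>i<length ts. \<forall>j<length ts.
        (fst (ts ! i) = fst (ts ! j) \<and> snd (ts ! i) < snd (ts ! j) \<or>
         snd (ts ! i) = snd (ts ! j) \<and> fst (ts ! i) < fst (ts ! j)) \<longrightarrow> i < j)}"

text \<open>The recursion \<open>deg T = d\<^sub>A(\<mu>) + deg T\<^bsub>\<le>d-1\<^esub>\<close>, unrolled.\<close>

definition tab_deg :: "nat \<Rightarrow> tableau \<Rightarrow> int" where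
  "tab_deg e ts = (\<Sum>k<length ts. node_deg e (ts ! k) (set (take (Suc k) ts)))"

definition res_seq :: "nat \<Rightarrow> tableau \<Rightarrow> nat list" where
  "res_seq e ts = map (res e) ts"

definition weights :: "nat \<Rightarrow> nat \<Rightarrow> nat list set" where
  "weights e d = {i. length i = d \<and> set i \<subseteq> {..<e}}"


section \<open>Ladders\<close>

definition ladder :: "nat \<Rightarrow> nat \<Rightarrow> node set" where
  "ladder e m = {(1 + k, m - k * (e - 1)) | k. k * (e - 1) < m}"

definition ladder_res :: "nat \<Rightarrow> nat \<Rightarrow> nat" where
  "ladder_res e m = (m - 1) mod e"

definition ladder_size :: "nat \<Rightarrow> diagram \<Rightarrow> nat \<Rightarrow> nat" where
  "ladder_size e \<mu> m = card (\<mu> \<inter> ladder e m)"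

text \<open>\<open>0\<close> for the empty diagram; \<open>ladder e 0\<close> is empty.\<close>

definition last_ladder :: "nat \<Rightarrow> diagram \<Rightarrow> nat" where
  "last_ladder e \<mu> = Max (insert 0 {m. ladder_size e \<mu> m \<noteq> 0})"

text \<open>
  The last member \<open>A\<^sub>r\<close> of the bottom removable sequence, that is, the member of the last
  ladder lying in the highest row.
\<close>

definition bottom_seq_last :: "nat \<Rightarrow> diagram \<Rightarrow> node" where
  "bottom_seq_last e \<mu> = arg_min fst (\<lambda>A. A \<in> \<mu> \<inter> ladder e (last_ladder e \<mu>))"

fun ladder_weight_aux :: "nat \<Rightarrow> nat \<Rightarrow> diagram \<Rightarrow> nat list" where
  "ladder_weight_aux e 0 \<mu> = []"
| "ladder_weight_aux e (Suc n) \<mu> =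
     (let A = bottom_seq_last e \<mu> in ladder_weight_aux e n (\<mu> - {A}) @ [res e A])"

definition ladder_weight :: "nat \<Rightarrow> diagram \<Rightarrow> nat list" where
  "ladder_weight e \<mu> = ladder_weight_aux e (card \<mu>) \<mu>"


section \<open>The Fock space\<close>

text \<open>\<open>\<rat>(q)\<close> is the fraction field of \<open>\<rat>[q]\<close>.\<close>

type_synonym ratfun = "rat poly fract"

definition qv :: ratfun where
  "qv = Fract [:0, 1:] 1"

definition qint :: "nat \<Rightarrow> ratfun" where
  "qint n = (qv powi int n - qv powi (- int n)) / (qv - inverse qv)"

definition qfact :: "nat \<Rightarrow> ratfun" where
  "qfact n = (\<Prod>k=1..n. qint k)"

text \<open>\<open>\<int>[q, q\<inverse>]\<close> and \<open>q\<int>[q]\<close> as subsets of \<open>\<rat>(q)\<close>.\<close>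

definition laurent_ring :: "ratfun set" where
  "laurent_ring = {poly (map_poly of_int p) qv / qv ^ n | (p :: int poly) n. True}"

definition q_poly_ideal :: "ratfun set" where
  "q_poly_ideal = {qv * poly (map_poly of_int p) qv | p :: int poly. True}"

type_synonym fock = "diagram \<Rightarrow>\<^sub>0 ratfun"

definition fscale :: "ratfun \<Rightarrow> fock \<Rightarrow> fock" where
  "fscale c v = Poly_Mapping.map ((*) c) v"

definition fbasis :: "diagram \<Rightarrow> fock" where
  "fbasis \<mu> = Poly_Mapping.single \<mu> 1"

definition f_op :: "nat \<Rightarrow> nat \<Rightarrow> fock \<Rightarrow> fock" where
  "f_op e i v = (\<Sum>\<mu>\<in>Poly_Mapping.keys v. fscale (Poly_Mapping.lookup v \<mu>)
     (\<Sum>B | addable \<mu> B \<and> res e B = i.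
        fscale (qv powi node_deg e B (insert B \<mu>)) (fbasis (insert B \<mu>))))"

definition f_div :: "nat \<Rightarrow> nat \<Rightarrow> nat \<Rightarrow> fock \<Rightarrow> fock" where
  "f_div e i r v = fscale (inverse (qfact r)) ((f_op e i ^^ r) v)"

text \<open>
  \<open>V(\<Lambda>\<^sub>0)\<close>.  Since the empty partition is a highest weight vector, the submodule it generates
  is already generated by the lowering operators.
\<close>

inductive_set V_Lambda0 :: "nat \<Rightarrow> fock set" for e :: nat where
  vacuum: "fbasis {} \<in> V_Lambda0 e"
| add: "v \<in> V_Lambda0 e \<Longrightarrow> w \<in> V_Lambda0 e \<Longrightarrow> v + w \<in> V_Lambda0 e"
| scale: "v \<in> V_Lambda0 e \<Longrightarrow> fscale c v \<in> V_Lambda0 e"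
| lower: "v \<in> V_Lambda0 e \<Longrightarrow> i < e \<Longrightarrow> f_op e i v \<in> V_Lambda0 e"

inductive_set divided_monomials :: "nat \<Rightarrow> fock set" for e :: nat where
  vacuum: "fbasis {} \<in> divided_monomials e"
| lower: "v \<in> divided_monomials e \<Longrightarrow> i < e \<Longrightarrow> f_div e i r v \<in> divided_monomials e"

definition integral_form :: "nat \<Rightarrow> fock set" where
  "integral_form e = {\<Sum>x\<in>X. fscale (c x) x | X c.
     finite X \<and> X \<subseteq> divided_monomials e \<and> (\<forall>x\<in>X. c x \<in> laurent_ring)}"

definition is_bar_involution :: "nat \<Rightarrow> (fock \<Rightarrow> fock) \<Rightarrow> bool" where
  "is_bar_involution e bar \<longleftrightarrow>
     (\<forall>v\<in>V_Lambda0 e. bar v \<in> V_Lambda0 e) \<and>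
     (\<forall>v\<in>V_Lambda0 e. \<forall>w\<in>V_Lambda0 e. bar (v + w) = bar v + bar w) \<and>
     (\<forall>v\<in>V_Lambda0 e. \<forall>c. bar (fscale (Fract [:c:] 1) v) = fscale (Fract [:c:] 1) (bar v)) \<and>
     (\<forall>v\<in>V_Lambda0 e. bar (fscale qv v) = fscale (inverse qv) (bar v)) \<and>
     bar (fbasis {}) = fbasis {} \<and>
     (\<forall>v\<in>V_Lambda0 e. \<forall>i<e. bar (f_op e i v) = f_op e i (bar v))"

definition is_canonical_basis_element ::
    "nat \<Rightarrow> (fock \<Rightarrow> fock) \<Rightarrow> diagram \<Rightarrow> fock \<Rightarrow> bool" where
  "is_canonical_basis_element e bar \<kappa> g \<longleftrightarrow>
     g \<in> integral_form e \<and> bar g = g \<and>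
     (\<forall>\<mu>. Poly_Mapping.lookup (g - fbasis \<kappa>) \<mu> \<in> q_poly_ideal)"

definition LLT_approx :: "nat \<Rightarrow> diagram \<Rightarrow> fock" where
  "LLT_approx e \<kappa> =
     foldl (\<lambda>v m. f_div e (ladder_res e m) (ladder_size e \<kappa> m) v) (fbasis {})
       [1..<Suc (last_ladder e \<kappa>)]"

definition r_factor :: "nat \<Rightarrow> diagram \<Rightarrow> ratfun" where
  "r_factor e \<kappa> = (\<Prod>m=1..last_ladder e \<kappa>. qfact (ladder_size e \<kappa> m))"


section \<open>The Hecke algebra by generators and relations\<close>

text \<open>
  The free algebra is the monoid algebra of the words in the generators; \<open>H\<^sub>d\<close> is its quotient
  by the two-sided ideal generated by the Hecke relations.
\<close>

datatype word = Word (letters: "nat list")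

instantiation word :: monoid_add
begin
definition zero_word :: word where "zero_word = Word []"
definition plus_word :: "word \<Rightarrow> word \<Rightarrow> word" where
  "plus_word u w = Word (letters u @ letters w)"
instance by standard (simp_all add: zero_word_def plus_word_def)
end

type_synonym 'k free_alg = "word \<Rightarrow>\<^sub>0 'k"

definition free_alg_on :: "nat \<Rightarrow> 'k::ring_1 free_alg set" where
  "free_alg_on d = {h. \<forall>w\<in>Poly_Mapping.keys h. set (letters w) \<subseteq> {1..<d}}"

definition mon :: "nat list \<Rightarrow> 'k::ring_1 free_alg" where
  "mon rs = Poly_Mapping.single (Word rs) 1"

definition const :: "'k \<Rightarrow> 'k::ring_1 free_alg" where
  "const c = Poly_Mapping.single 0 c"

definition hecke_relators :: "'k::ring_1 \<Rightarrow> nat \<Rightarrow> 'k free_alg set" where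
  "hecke_relators \<xi> d =
     {mon [r, r] - (const (\<xi> - 1) * mon [r] + const \<xi>) | r. 1 \<le> r \<and> r < d} \<union>
     {mon [r, r + 1, r] - mon [r + 1, r, r + 1] | r. 1 \<le> r \<and> r + 1 < d} \<union>
     {mon [r, s] - mon [s, r] | r s. 1 \<le> r \<and> r + 1 < s \<and> s < d}"

inductive_set two_sided_ideal :: "nat \<Rightarrow> 'k::ring_1 free_alg set \<Rightarrow> 'k free_alg set"
  for d :: nat and R :: "'k free_alg set" where
  zero: "0 \<in> two_sided_ideal d R"
| step: "x \<in> two_sided_ideal d R \<Longrightarrow> r \<in> R \<Longrightarrow> a \<in> free_alg_on d \<Longrightarrow> b \<in> free_alg_on d
          \<Longrightarrow> x + a * r * b \<in> two_sided_ideal d R"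

definition word_perm :: "nat list \<Rightarrow> nat \<Rightarrow> nat" where
  "word_perm rs = foldr (\<lambda>r f. transpose r (r + 1) \<circ> f) rs id"

text \<open>A fixed reduced expression of each \<open>w \<in> S\<^sub>d\<close>; \<open>T\<^sub>w\<close> does not depend on it in \<open>H\<^sub>d\<close>.\<close>

definition reduced_word :: "nat \<Rightarrow> (nat \<Rightarrow> nat) \<Rightarrow> nat list" where
  "reduced_word d w = (SOME rs. set rs \<subseteq> {1..<d} \<and> word_perm rs = w \<and>
     (\<forall>rs'. set rs' \<subseteq> {1..<d} \<and> word_perm rs' = w \<longrightarrow> length rs \<le> length rs'))"

text \<open>The initial tableau \<open>T\<^sup>\<mu>\<close>, filled along successive rows.\<close>

definition initial_tableau :: "diagram \<Rightarrow> tableau" where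
  "initial_tableau \<mu> =
     concat (map (\<lambda>a. map (\<lambda>b. (a, b)) [1..<Suc (row_len \<mu> a)]) [1..<Suc (card \<mu>)])"

definition row_stabilizer :: "nat \<Rightarrow> diagram \<Rightarrow> (nat \<Rightarrow> nat) set" where
  "row_stabilizer d \<mu> = {w. w permutes {1..d} \<and>
     (\<forall>k\<in>{1..d}. fst (initial_tableau \<mu> ! (w k - 1)) = fst (initial_tableau \<mu> ! (k - 1)))}"

text \<open>The permutation \<open>w\<^sub>T\<close> of the labels with \<open>w\<^sub>T T\<^sup>\<mu> = T\<close>.\<close>

definition tableau_perm :: "nat \<Rightarrow> diagram \<Rightarrow> tableau \<Rightarrow> nat \<Rightarrow> nat" where
  "tableau_perm d \<mu> ts k =
     (if k \<in> {1..d} then THE l. l \<in> {1..d} \<and> ts ! (l - 1) = initial_tableau \<mu> ! (k - 1) else k)"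

text \<open>\<open>m\<^sub>\<mu> = \<Sum> T\<^sub>w\<close>, the sum over the row stabilizer of \<open>T\<^sup>\<mu>\<close>.\<close>

definition m_elt :: "nat \<Rightarrow> diagram \<Rightarrow> 'k::ring_1 free_alg" where
  "m_elt d \<mu> = (\<Sum>w\<in>row_stabilizer d \<mu>. mon (reduced_word d w))"

text \<open>
  The preimage in the free algebra of the ideal of \<open>H\<^sub>d\<close> spanned by the Murphy basis elements
  \<open>T\<^sub>u\<^sup>* m\<^sub>\<nu> T\<^sub>w\<close> of shapes \<open>\<nu>\<close> strictly dominating \<open>\<mu>\<close>.
\<close>

definition dominating_ideal :: "'k::ring_1 \<Rightarrow> nat \<Rightarrow> diagram \<Rightarrow> 'k free_alg set" where
  "dominating_ideal \<xi> d \<mu> = two_sided_ideal d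
     (hecke_relators \<xi> d \<union> m_elt d ` {\<nu> \<in> partitions_of d. strictly_dominates \<nu> \<mu>})"


section \<open>Graded modules over the Hecke algebra\<close>

definition primitive_root_of_unity :: "nat \<Rightarrow> 'k::field \<Rightarrow> bool" where
  "primitive_root_of_unity e \<xi> \<longleftrightarrow> \<xi> ^ e = 1 \<and> (\<forall>k. 0 < k \<and> k < e \<longrightarrow> \<xi> ^ k \<noteq> 1)"

definition swap_at :: "nat \<Rightarrow> nat list \<Rightarrow> nat list" where
  "swap_at r i = i[r - 1 := i ! r, r := i ! (r - 1)]"

text \<open>The quiver with vertices \<open>\<int>/e\<int>\<close> and arrows \<open>a \<rightarrow> a + 1\<close>, and its Cartan matrix.\<close>

definition arrow :: "nat \<Rightarrow> nat \<Rightarrow> nat \<Rightarrow> bool" where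
  "arrow e a b \<longleftrightarrow> b = (a + 1) mod e"

definition cartan :: "nat \<Rightarrow> nat \<Rightarrow> nat \<Rightarrow> int" where
  "cartan e a b = (if a = b then 2 else
     - (if arrow e a b then 1 else 0) - (if arrow e b a then 1 else 0))"

text \<open>
  A graded module on a subspace of an ambient vector space: the action of the generators
  \<open>T\<^sub>r\<close>, the action of the KLR generators \<open>e(i), y\<^sub>r, \<psi>\<^sub>r\<close>, and the homogeneous components.
  The operators matter only on \<open>space\<close>.
\<close>

record 'v hmod =
  space :: "'v set"
  opT :: "nat \<Rightarrow> 'v \<Rightarrow> 'v"
  opE :: "nat list \<Rightarrow> 'v \<Rightarrow> 'v"
  opY :: "nat \<Rightarrow> 'v \<Rightarrow> 'v"
  opPsi :: "nat \<Rightarrow> 'v \<Rightarrow> 'v"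
  homog :: "int \<Rightarrow> 'v set"

text \<open>
  A copy of the locale \<^locale>\<open>vector_space\<close>, to keep the following definitions out of the existing
  interpretations of the latter.
\<close>

locale ambient_space = vector_space scale
  for scale :: "'a::field \<Rightarrow> 'b::ab_group_add \<Rightarrow> 'b"  (infixr \<open>*s\<close> 75)
begin

definition lin_map :: "'b set \<Rightarrow> 'b set \<Rightarrow> ('b \<Rightarrow> 'b) \<Rightarrow> bool" where
  "lin_map U W \<phi> \<longleftrightarrow> (\<forall>v\<in>U. \<phi> v \<in> W) \<and> (\<forall>v\<in>U. \<forall>w\<in>U. \<phi> (v + w) = \<phi> v + \<phi> w) \<and>
     (\<forall>c. \<forall>v\<in>U. \<phi> (c *s v) = c *s \<phi> v)"

definition free_act :: "(nat \<Rightarrow> 'b \<Rightarrow> 'b) \<Rightarrow> 'a free_alg \<Rightarrow> 'b \<Rightarrow> 'b" where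
  "free_act T h v = (\<Sum>w\<in>Poly_Mapping.keys h. Poly_Mapping.lookup h w *s foldr T (letters w) v)"

definition hecke_module :: "'a \<Rightarrow> nat \<Rightarrow> 'b hmod \<Rightarrow> bool" where
  "hecke_module \<xi> d M \<longleftrightarrow>
     (\<exists>B. finite B \<and> space M = span B) \<and>
     (\<forall>r\<in>{1..<d}. lin_map (space M) (space M) (opT M r)) \<and>
     (\<forall>h\<in>hecke_relators \<xi> d. \<forall>v\<in>space M. free_act (opT M) h v = 0)"

definition jucys_murphy :: "'a \<Rightarrow> 'b hmod \<Rightarrow> nat \<Rightarrow> 'b \<Rightarrow> 'b" where
  "jucys_murphy \<xi> M r v =
     inverse \<xi> ^ (r - 1) *s foldr (opT M) (rev [1..<r] @ [1..<r]) v"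

definition weight_space :: "'a \<Rightarrow> nat \<Rightarrow> 'b hmod \<Rightarrow> nat list \<Rightarrow> 'b set" where
  "weight_space \<xi> d M i = {v \<in> space M. \<forall>r\<in>{1..d}. \<exists>N.
     ((\<lambda>u. jucys_murphy \<xi> M r u - \<xi> ^ (i ! (r - 1)) *s u) ^^ N) v = 0}"

text \<open>
  Modules over the level one cyclotomic KLR algebra of weight \<open>\<Lambda>\<^sub>0\<close>, by generators and relations.
\<close>

definition klr_module :: "nat \<Rightarrow> nat \<Rightarrow> 'b hmod \<Rightarrow> bool" where
  "klr_module e d M \<longleftrightarrow>
     (let V = space M; E = opE M; y = opY M; \<psi> = opPsi M in
      (\<forall>i\<in>weights e d. lin_map V V (E i)) \<and>
      (\<forall>r\<in>{1..d}. lin_map V V (y r)) \<and>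
      (\<forall>r\<in>{1..<d}. lin_map V V (\<psi> r)) \<and>
      (\<forall>v\<in>V.
        (\<forall>i\<in>weights e d. \<forall>j\<in>weights e d. E i (E j v) = (if i = j then E i v else 0)) \<and>
        (\<Sum>i\<in>weights e d. E i v) = v \<and>
        (\<forall>r\<in>{1..d}. \<forall>i\<in>weights e d. y r (E i v) = E i (y r v)) \<and>
        (\<forall>r\<in>{1..<d}. \<forall>i\<in>weights e d. \<psi> r (E i v) = E (swap_at r i) (\<psi> r v)) \<and>
        (\<forall>r\<in>{1..d}. \<forall>s\<in>{1..d}. y r (y s v) = y s (y r v)) \<and>
        (\<forall>r\<in>{1..<d}. \<forall>s\<in>{1..d}. s \<noteq> r \<and> s \<noteq> r + 1 \<longrightarrow> \<psi> r (y s v) = y s (\<psi> r v)) \<and>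
        (\<forall>r\<in>{1..<d}. \<forall>s\<in>{1..<d}. r + 1 < s \<longrightarrow> \<psi> r (\<psi> s v) = \<psi> s (\<psi> r v))) \<and>
      (\<forall>i\<in>weights e d. \<forall>v\<in>V. E i v = v \<longrightarrow>
        (\<forall>r\<in>{1..<d}. let a = i ! (r - 1); b = i ! r in
          \<psi> r (y (r + 1) v) = y r (\<psi> r v) + (if a = b then v else 0) \<and>
          y (r + 1) (\<psi> r v) = \<psi> r (y r v) + (if a = b then v else 0) \<and>
          \<psi> r (\<psi> r v) =
            (if a = b then 0
             else if arrow e a b \<and> arrow e b a
               then y (r + 1) (y r v - y (r + 1) v) - y r (y r v - y (r + 1) v)
             else if arrow e a b then y (r + 1) v - y r v
             else if arrow e b a then y r v - y (r + 1) v
             else v)) \<and>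
        (\<forall>r\<in>{1..<d}. r + 1 < d \<longrightarrow> (let a = i ! (r - 1); b = i ! r; c = i ! (r + 1) in
          \<psi> r (\<psi> (r + 1) (\<psi> r v)) = \<psi> (r + 1) (\<psi> r (\<psi> (r + 1) v)) +
            (if c = a \<and> arrow e a b \<and> arrow e b a
               then y r v + y (r + 2) v - y (r + 1) v - y (r + 1) v
             else if c = a \<and> arrow e a b then v
             else if c = a \<and> arrow e b a then - v
             else 0))) \<and>
        (0 < d \<longrightarrow> (if i ! 0 = 0 then y 1 v = 0 else v = 0))))"

text \<open>
  The Brundan--Kleshchev isomorphism, which gives the action of the KLR generators in terms of
  that of \<open>H\<^sub>d\<close>: \<open>e(i)\<close> is the projection onto the \<open>i\<close>-weight space, and on this weight space
  \<open>X\<^sub>r = \<xi>\<^sup>i\<^sup>r (1 - y\<^sub>r)\<close> and \<open>T\<^sub>r = \<psi>\<^sub>r Q\<^sub>r(i) - P\<^sub>r(i)\<close>.  If \<open>i\<^sub>r = i\<^bsub>r+1\<^esub>\<close> then \<open>P\<^sub>r(i) = 1\<close> and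
  \<open>Q\<^sub>r(i) = 1 - \<xi> + \<xi> y\<^bsub>r+1\<^esub> - y\<^sub>r\<close>.  Otherwise \<open>D = X\<^sub>r - X\<^bsub>r+1\<^esub>\<close> is invertible on the weight space,
  \<open>P\<^sub>r(i) = (1 - \<xi>) (1 - X\<^sub>r X\<^bsub>r+1\<^esub>\<inverse>)\<inverse> = (\<xi> - 1) X\<^bsub>r+1\<^esub> D\<inverse>\<close>, and \<open>Q\<^sub>r(i)\<close> is
  \<open>\<xi>\<^sup>i\<^sup>r D\<inverse>\<close> if \<open>i\<^sub>r \<rightleftharpoons> i\<^bsub>r+1\<^esub>\<close>, \<open>(X\<^sub>r - \<xi> X\<^bsub>r+1\<^esub>) D\<inverse> D\<inverse>\<close> if \<open>i\<^sub>r \<rightarrow> i\<^bsub>r+1\<^esub>\<close>, \<open>\<xi>\<^sup>i\<^sup>r\<close> if \<open>i\<^sub>r \<leftarrow> i\<^bsub>r+1\<^esub>\<close>,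
  and \<open>(X\<^sub>r - \<xi> X\<^bsub>r+1\<^esub>) D\<inverse>\<close> if \<open>i\<^sub>r\<close>, \<open>i\<^bsub>r+1\<^esub>\<close> are not adjacent.  The identities below are these
  formulas applied to \<open>D v\<close> or \<open>D (D v)\<close>, which is no loss because \<open>D\<close> is invertible.
\<close>

definition bk_compatible :: "nat \<Rightarrow> 'a \<Rightarrow> nat \<Rightarrow> 'b hmod \<Rightarrow> bool" where
  "bk_compatible e \<xi> d M \<longleftrightarrow>
     (let X = jucys_murphy \<xi> M; T = opT M; y = opY M; \<psi> = opPsi M in
      \<forall>i\<in>weights e d.
        opE M i ` space M = weight_space \<xi> d M i \<and>
        (\<forall>v\<in>weight_space \<xi> d M i.
          (\<forall>r\<in>{1..d}. X r v = \<xi> ^ (i ! (r - 1)) *s (v - y r v)) \<and>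
          (\<forall>r\<in>{1..<d}.
            let a = i ! (r - 1); b = i ! r;
                D = (\<lambda>u. X r u - X (r + 1) u);
                N = (\<lambda>u. X r u - \<xi> *s X (r + 1) u);
                P = (\<lambda>u. (\<xi> - 1) *s X (r + 1) u)
            in
              if a = b then T r v = \<psi> r ((1 - \<xi>) *s v + \<xi> *s y (r + 1) v - y r v) - v
              else if arrow e a b \<and> arrow e b a then T r (D v) = \<psi> r (\<xi> ^ a *s v) - P v
              else if arrow e a b then T r (D (D v)) = \<psi> r (N v) - P (D v)
              else if arrow e b a then T r (D v) = \<psi> r (\<xi> ^ a *s D v) - P v
              else T r (D v) = \<psi> r (N v) - P v)))"

definition graded_by_homog :: "nat \<Rightarrow> nat \<Rightarrow> 'b hmod \<Rightarrow> bool" where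
  "graded_by_homog e d M \<longleftrightarrow>
     (\<forall>m. subspace (homog M m) \<and> homog M m \<subseteq> space M) \<and>
     (\<forall>v\<in>space M. \<exists>!f. finite {m. f m \<noteq> 0} \<and> (\<forall>m. f m \<in> homog M m) \<and>
        v = (\<Sum>m | f m \<noteq> 0. f m)) \<and>
     (\<forall>m. \<forall>v\<in>homog M m.
        (\<forall>i\<in>weights e d. opE M i v \<in> homog M m) \<and>
        (\<forall>r\<in>{1..d}. opY M r v \<in> homog M (m + 2)) \<and>
        (\<forall>r\<in>{1..<d}. \<forall>i\<in>weights e d.
           opPsi M r (opE M i v) \<in> homog M (m - cartan e (i ! (r - 1)) (i ! r))))"

definition graded_module :: "nat \<Rightarrow> 'a \<Rightarrow> nat \<Rightarrow> 'b hmod \<Rightarrow> bool" where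
  "graded_module e \<xi> d M \<longleftrightarrow>
     hecke_module \<xi> d M \<and> klr_module e d M \<and> bk_compatible e \<xi> d M \<and> graded_by_homog e d M"

definition qdim :: "'b hmod \<Rightarrow> 'b set \<Rightarrow> ratfun" where
  "qdim M W = (\<Sum>m | W \<inter> homog M m \<noteq> {0}. of_nat (dim (W \<inter> homog M m)) * qv powi m)"

text \<open>\<open>ch\<^sub>q M\<close>, as the function giving the coefficient of each \<open>i \<in> I\<^sup>d\<close>.\<close>

definition ch_q :: "'a \<Rightarrow> nat \<Rightarrow> 'b hmod \<Rightarrow> nat list \<Rightarrow> ratfun" where
  "ch_q \<xi> d M i = qdim M (weight_space \<xi> d M i)"

definition ladder_mult :: "nat \<Rightarrow> 'a \<Rightarrow> nat \<Rightarrow> diagram \<Rightarrow> 'b hmod \<Rightarrow> ratfun" where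
  "ladder_mult e \<xi> d \<kappa> M = ch_q \<xi> d M (ladder_weight e \<kappa>)"


subsection \<open>Specht modules\<close>

text \<open>
  The Dipper--James--Mathas Specht module \<open>(H\<^sub>d m\<^sub>\<mu> + J) / J\<close>, where \<open>J\<close> is the ideal of Murphy basis
  elements of more dominant shape: a cyclic module whose generator \<open>z\<close>, the class of \<open>m\<^sub>\<mu>\<close>, is
  annihilated by exactly those \<open>h\<close> with \<open>h m\<^sub>\<mu> \<in> J\<close>.
\<close>

definition specht_generator :: "'a \<Rightarrow> nat \<Rightarrow> diagram \<Rightarrow> 'b hmod \<Rightarrow> 'b \<Rightarrow> bool" where
  "specht_generator \<xi> d \<mu> M z \<longleftrightarrow>
     space M = (\<lambda>h. free_act (opT M) h z) ` free_alg_on d \<and>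
     (\<forall>h\<in>free_alg_on d. free_act (opT M) h z = 0 \<longleftrightarrow> h * m_elt d \<mu> \<in> dominating_ideal \<xi> d \<mu>)"

text \<open>\<open>v\<^sub>T = \<psi>\<^bsub>r\<^sub>1\<^esub> \<dots> \<psi>\<^bsub>r\<^sub>k\<^esub> z\<close> for the fixed reduced expression of \<open>w\<^sub>T\<close>.\<close>

definition bkw_vector :: "nat \<Rightarrow> diagram \<Rightarrow> 'b hmod \<Rightarrow> 'b \<Rightarrow> tableau \<Rightarrow> 'b" where
  "bkw_vector d \<mu> M z ts = foldr (opPsi M) (reduced_word d (tableau_perm d \<mu> ts)) z"

text \<open>
  The Brundan--Kleshchev--Wang grading: the basis vectors \<open>v\<^sub>T\<close>, each of which has weight
  \<open>i\<^sup>T\<close>, are declared to be homogeneous of degree \<open>deg T\<close>.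
\<close>

definition graded_specht :: "nat \<Rightarrow> 'a \<Rightarrow> nat \<Rightarrow> diagram \<Rightarrow> 'b hmod \<Rightarrow> bool" where
  "graded_specht e \<xi> d \<mu> M \<longleftrightarrow> graded_module e \<xi> d M \<and>
     (\<exists>z. specht_generator \<xi> d \<mu> M z \<and>
       (let v = bkw_vector d \<mu> M z in
        inj_on v (standard_tableaux \<mu>) \<and>
        independent (v ` standard_tableaux \<mu>) \<and>
        span (v ` standard_tableaux \<mu>) = space M \<and>
        (\<forall>ts\<in>standard_tableaux \<mu>. v ts \<in> weight_space \<xi> d M (res_seq e ts)) \<and>
        (\<forall>m. homog M m = span (v ` {ts \<in> standard_tableaux \<mu>. tab_deg e ts = m}))))"


subsection \<open>Irreducible modules\<close>

definition submodule :: "nat \<Rightarrow> 'b hmod \<Rightarrow> 'b set \<Rightarrow> bool" where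
  "submodule d M N \<longleftrightarrow> subspace N \<and> N \<subseteq> space M \<and> (\<forall>r\<in>{1..<d}. \<forall>v\<in>N. opT M r v \<in> N)"

definition maximal_submodule :: "nat \<Rightarrow> 'b hmod \<Rightarrow> 'b set \<Rightarrow> bool" where
  "maximal_submodule d M N \<longleftrightarrow> submodule d M N \<and> N \<noteq> space M \<and>
     (\<forall>N'. submodule d M N' \<and> N \<subseteq> N' \<longrightarrow> N' = N \<or> N' = space M)"

definition radical :: "nat \<Rightarrow> 'b hmod \<Rightarrow> 'b set" where
  "radical d M = space M \<inter> \<Inter>{N. maximal_submodule d M N}"

text \<open>\<open>\<phi>\<close> induces an isomorphism from \<open>N / N'\<close> to \<open>L\<close>, for submodules \<open>N' \<subseteq> N\<close> of \<open>M\<close>.\<close>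

definition quotient_map ::
    "nat \<Rightarrow> 'b hmod \<Rightarrow> 'b set \<Rightarrow> 'b set \<Rightarrow> 'b hmod \<Rightarrow> ('b \<Rightarrow> 'b) \<Rightarrow> bool" where
  "quotient_map d M N N' L \<phi> \<longleftrightarrow>
     lin_map N (space L) \<phi> \<and> (\<forall>r\<in>{1..<d}. \<forall>v\<in>N. \<phi> (opT M r v) = opT L r (\<phi> v)) \<and>
     \<phi> ` N = space L \<and> {v \<in> N. \<phi> v = 0} = N'"

definition is_head :: "nat \<Rightarrow> 'b hmod \<Rightarrow> 'b hmod \<Rightarrow> bool" where
  "is_head d M L \<longleftrightarrow> (\<exists>\<phi>. quotient_map d M (space M) (radical d M) L \<phi>)"

text \<open>
  The graded dual, consisting of the linear forms on \<open>space M\<close> (extended by 0 outside), its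
  component of degree \<open>m\<close> being the dual of the component of \<open>M\<close> of degree \<open>-m\<close>.  A KLR generator
  \<open>x\<close> acts on it by \<open>(x f) v = f (x v)\<close>, because the antiautomorphism fixes \<open>x\<close>.
\<close>

definition dual_space :: "'b hmod \<Rightarrow> ('b \<Rightarrow> 'a) set" where
  "dual_space M = {f. (\<forall>v\<in>space M. \<forall>w\<in>space M. f (v + w) = f v + f w) \<and>
     (\<forall>c. \<forall>v\<in>space M. f (c *s v) = c * f v) \<and> (\<forall>v. v \<notin> space M \<longrightarrow> f v = 0)}"

definition dual_homog :: "'b hmod \<Rightarrow> int \<Rightarrow> ('b \<Rightarrow> 'a) set" where
  "dual_homog M m = {f \<in> dual_space M. \<forall>n. n \<noteq> - m \<longrightarrow> (\<forall>v\<in>homog M n. f v = 0)}"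

definition graded_self_dual :: "nat \<Rightarrow> nat \<Rightarrow> 'b hmod \<Rightarrow> bool" where
  "graded_self_dual e d M \<longleftrightarrow> (\<exists>\<Phi>. bij_betw \<Phi> (space M) (dual_space M) \<and>
     (\<forall>v\<in>space M. \<forall>w\<in>space M. \<forall>u\<in>space M. \<Phi> (v + w) u = \<Phi> v u + \<Phi> w u) \<and>
     (\<forall>c. \<forall>v\<in>space M. \<forall>u\<in>space M. \<Phi> (c *s v) u = c * \<Phi> v u) \<and>
     (\<forall>m. \<Phi> ` homog M m = dual_homog M m) \<and>
     (\<forall>v\<in>space M. \<forall>u\<in>space M.
        (\<forall>i\<in>weights e d. \<Phi> (opE M i v) u = \<Phi> v (opE M i u)) \<and>
        (\<forall>r\<in>{1..d}. \<Phi> (opY M r v) u = \<Phi> v (opY M r u)) \<and>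
        (\<forall>r\<in>{1..<d}. \<Phi> (opPsi M r v) u = \<Phi> v (opPsi M r u))))"

text \<open>\<open>L\<close> is the graded self-dual form of the head of the Specht module \<open>M\<close>.\<close>

definition graded_irreducible :: "nat \<Rightarrow> 'a \<Rightarrow> nat \<Rightarrow> 'b hmod \<Rightarrow> 'b hmod \<Rightarrow> bool" where
  "graded_irreducible e \<xi> d M L \<longleftrightarrow>
     graded_module e \<xi> d L \<and> is_head d M L \<and> graded_self_dual e d L"


subsection \<open>Graded decomposition numbers\<close>

definition graded_submodule :: "nat \<Rightarrow> 'b hmod \<Rightarrow> 'b set \<Rightarrow> bool" where
  "graded_submodule d M N \<longleftrightarrow> submodule d M N \<and>
     (\<forall>v\<in>N. \<exists>f. finite {m. f m \<noteq> 0} \<and> (\<forall>m. f m \<in> N \<inter> homog M m) \<and> v = (\<Sum>m | f m \<noteq> 0. f m))"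

text \<open>
  A graded composition series \<open>0 = N\<^sub>0 \<subseteq> \<dots> \<subseteq> N\<^sub>n = M\<close> whose \<open>k\<close>-th factor is \<open>D \<nu> \<langle>m\<rangle>\<close>, where
  \<open>(\<nu>, m)\<close> is the \<open>k\<close>-th entry of \<open>fs\<close>; here \<open>D \<nu> \<langle>m\<rangle>\<close> has component \<open>homog (D \<nu>) (n - m)\<close> in degree \<open>n\<close>.
\<close>

definition graded_composition_series ::
    "nat \<Rightarrow> nat \<Rightarrow> 'b hmod \<Rightarrow> (diagram \<Rightarrow> 'b hmod) \<Rightarrow> 'b set list \<Rightarrow> (diagram \<times> int) list \<Rightarrow> bool" where
  "graded_composition_series e d M D Ns fs \<longleftrightarrow>
     length Ns = length fs + 1 \<and> Ns ! 0 = {0} \<and> Ns ! length fs = space M \<and>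
     (\<forall>N\<in>set Ns. graded_submodule d M N) \<and>
     (\<forall>k<length fs. case fs ! k of (\<nu>, m) \<Rightarrow>
        \<nu> \<in> restricted_partitions_of e d \<and>
        (\<exists>\<phi>. quotient_map d M (Ns ! (k + 1)) (Ns ! k) (D \<nu>) \<phi> \<and>
          (\<forall>n. \<phi> ` (Ns ! (k + 1) \<inter> homog M n) \<subseteq> homog (D \<nu>) (n - m))))"

definition is_graded_decomposition_matrix ::
    "nat \<Rightarrow> nat \<Rightarrow> (diagram \<Rightarrow> 'b hmod) \<Rightarrow> (diagram \<Rightarrow> 'b hmod) \<Rightarrow> (diagram \<Rightarrow> diagram \<Rightarrow> ratfun) \<Rightarrow> bool"
  where
  "is_graded_decomposition_matrix e d S D dec \<longleftrightarrow>
     (\<forall>\<mu>\<in>partitions_of d. \<exists>Ns fs. graded_composition_series e d (S \<mu>) D Ns fs \<and>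
        (\<forall>\<nu>\<in>restricted_partitions_of e d.
           dec \<mu> \<nu> = sum_list (map (\<lambda>(\<nu>', m). if \<nu>' = \<nu> then qv powi m else 0) fs)))"

end

end

theory Submission
  imports Defs
begin

text \<open>
  The quantum factorials cancel the divided powers, so \<open>r\<^sub>\<lambda> A(\<lambda>) = f\<^bsub>j\<^sub>d\<^esub> \<dots> f\<^bsub>j\<^sub>1\<^esub> \<emptyset>\<close> with \<open>j\<close> the
  ladder weight, and the coefficient of \<open>\<mu>\<close> in it is \<open>\<Sum> q\<^bsup>deg T\<^esup>\<close> over the standard \<open>\<mu>\<close>-tableaux \<open>T\<close> of
  residue sequence \<open>j\<close>, that is, \<open>m\<^sub>\<lambda>(S(\<mu>))\<close>.  Graded characters are additive along graded composition
  series, so this is \<open>\<Sum>\<^sub>\<nu> d\<^bsub>\<mu>,\<nu>\<^esub> m\<^sub>\<lambda>(D(\<nu>))\<close>, and hence \<open>r\<^sub>\<lambda> A(\<lambda>) = \<Sum>\<^sub>\<nu> m\<^sub>\<lambda>(D(\<nu>)) G(\<nu>)\<close>.  The \<open>G(\<nu>)\<close> are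
  linearly independent because \<open>G(\<nu>)\<close> is congruent to \<open>\<nu>\<close> modulo \<open>q\<close>.
\<close>

section \<open>Lowering operators and standard tableaux\<close>

text \<open>The obstacle is additivity of graded characters. Submodules in a composition series are
  stable under the \<open>T_r\<close>, and the map \<open>\<phi>\<close> onto a factor commutes with
  the \<open>T_r\<close> and shifts degrees; nothing is given about how either interacts with the
  KLR idempotents that cut out weight spaces. The bridge is the Jucys-Murphy elements, which are
  scalar multiples of words in the \<open>T_r\<close>: their eigenvalues separate weights because
  the powers of \<open>\<xi>\<close> below \<open>e\<close> are distinct, so every submodule
  contains the weight components of its vectors. Hence taking weight \<open>i\<close> and degree
  \<open>n\<close> at once is exact, and dimensions add up degree by degree before any generating
  function is formed. The comparison in the Fock space is made coefficient by coefficient. It yields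
  one linear equation for each partition of \<open>d\<close>, and the equations at restricted
  partitions form a square system that determines the unknowns.\<close>

lemma qv_nonzero [simp]: "qv \<noteq> 0"
  by (simp add: qv_def Zero_fract_def eq_fract)

lemma lookup_fscale [simp]:
  "Poly_Mapping.lookup (fscale c v) \<mu> = c * Poly_Mapping.lookup v \<mu>"
  unfolding fscale_def by (simp add: Poly_Mapping.map.rep_eq when_def)

lemma fscale_fscale: "fscale a (fscale c v) = fscale (a * c) v"
  by (rule poly_mapping_eqI) (simp add: mult.assoc)

lemma fscale_1 [simp]: "fscale 1 v = v"
  by (rule poly_mapping_eqI) simp

lemma lookup_fbasis: "Poly_Mapping.lookup (fbasis \<mu>) \<nu> = (if \<mu> = \<nu> then 1 else 0)"
  by (simp add: fbasis_def lookup_single)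

section \<open>Young diagrams and finiteness\<close>

lemma is_diagram_empty [simp]: "is_diagram {}"
  by (simp add: is_diagram_def)

lemma is_diagram_finite: "is_diagram \<mu> \<Longrightarrow> finite \<mu>"
  by (simp add: is_diagram_def)

lemma is_diagramD:
  assumes "is_diagram \<mu>" "(a, b) \<in> \<mu>" "1 \<le> a'" "a' \<le> a" "1 \<le> b'" "b' \<le> b"
  shows "(a', b') \<in> \<mu>"
  using assms unfolding is_diagram_def by fastforce

lemma is_diagram_pos: "is_diagram \<mu> \<Longrightarrow> (a, b) \<in> \<mu> \<Longrightarrow> 1 \<le> a \<and> 1 \<le> b"
  unfolding is_diagram_def by fastforce

text \<open>A node \<open>(a, b)\<close> forces \<open>a\<close> nodes in the first column and
  \<open>b\<close> nodes in the first row, so the size bounds both coordinates. All finiteness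
  statements about partitions and addable nodes rest on this.\<close>

lemma is_diagram_subset_square:
  assumes "is_diagram \<mu>" shows "\<mu> \<subseteq> {1..card \<mu>} \<times> {1..card \<mu>}"
proof
  fix A assume "A \<in> \<mu>"
  obtain a b where A: "A = (a, b)" by force
  have ab: "(a, b) \<in> \<mu>" "1 \<le> a" "1 \<le> b"
    using A \<open>A \<in> \<mu>\<close> is_diagram_pos[OF assms] by auto
  have "(\<lambda>x. (x, 1)) ` {1..a} \<subseteq> \<mu>" "Pair 1 ` {1..b} \<subseteq> \<mu>"
    using is_diagramD[OF assms ab(1)] ab by auto
  then have "card ((\<lambda>x. (x, 1::nat)) ` {1..a}) \<le> card \<mu>" "card (Pair (1::nat) ` {1..b}) \<le> card \<mu>"
    using is_diagram_finite[OF assms] by (simp_all add: card_mono)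
  moreover have "card ((\<lambda>x. (x, 1::nat)) ` {1..a}) = a" "card (Pair (1::nat) ` {1..b}) = b"
    by (simp_all add: card_image inj_on_def)
  ultimately show "A \<in> {1..card \<mu>} \<times> {1..card \<mu>}"
    using A ab by simp
qed

lemma finite_partitions_of: "finite (partitions_of d)"
proof (rule finite_subset)
  show "partitions_of d \<subseteq> Pow ({1..d} \<times> {1..d})"
    using is_diagram_subset_square by (auto simp: partitions_of_def)
qed simp

lemma finite_restricted_partitions_of: "finite (restricted_partitions_of e d)"
  by (rule finite_subset[OF _ finite_partitions_of]) (auto simp: restricted_partitions_of_def)

lemma finite_addable:
  assumes "is_diagram \<mu>" shows "finite {B. addable \<mu> B}"
proof (rule finite_subset)
  show "{B. addable \<mu> B} \<subseteq> {1..Suc (card \<mu>)} \<times> {1..Suc (card \<mu>)}"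
  proof
    fix B assume "B \<in> {B. addable \<mu> B}"
    then have B: "B \<notin> \<mu>" "is_diagram (insert B \<mu>)" by (auto simp: addable_def)
    then show "B \<in> {1..Suc (card \<mu>)} \<times> {1..Suc (card \<mu>)}"
      using is_diagram_subset_square[OF B(2)] is_diagram_finite[OF assms] by simp
  qed
qed simp

text \<open>The operator is defined by adding nodes to members of the support; a coefficient is read
  off by removing nodes instead. A pair \<open>(\<nu>, B)\<close> with
  \<open>insert B \<nu> = \<mu>\<close> is the same as a removable node \<open>B\<close> of
  \<open>\<mu>\<close>. The support condition makes \<open>\<mu> - {B}\<close> a diagram.\<close>

lemma lookup_f_op:
  assumes v: "Poly_Mapping.keys v \<subseteq> Collect is_diagram" and "is_diagram \<mu>"
  shows "Poly_Mapping.lookup (f_op e i v) \<mu> =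
    (\<Sum>A | removable \<mu> A \<and> res e A = i.
       Poly_Mapping.lookup v (\<mu> - {A}) * qv powi node_deg e A \<mu>)"
proof -
  let ?K = "Poly_Mapping.keys v"
  let ?g = "\<lambda>\<nu> B. Poly_Mapping.lookup v \<nu> * (qv powi node_deg e B (insert B \<nu>) * (if insert B \<nu> = \<mu> then 1 else 0))"
  let ?R = "{A. removable \<mu> A \<and> res e A = i}"
  let ?P = "Sigma ?K (\<lambda>\<nu>. {B. addable \<nu> B \<and> res e B = i})"
  have fin: "finite {B. addable \<nu> B \<and> res e B = i}" if "\<nu> \<in> ?K" for \<nu>
    by (rule finite_subset[OF _ finite_addable[of \<nu>]]) (use that v in auto)
  have finP: "finite ?P" using fin by (intro finite_SigmaI) simp_all
  have finR: "finite ?R"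
    by (rule finite_subset[OF _ is_diagram_finite[OF assms(2)]]) (auto simp: removable_def)
  have "Poly_Mapping.lookup (f_op e i v) \<mu> = (\<Sum>\<nu>\<in>?K. \<Sum>B | addable \<nu> B \<and> res e B = i. ?g \<nu> B)"
    unfolding f_op_def by (simp add: lookup_sum lookup_fbasis sum_distrib_left)
  also have "\<dots> = (\<Sum>(\<nu>, B)\<in>?P. ?g \<nu> B)"
    by (rule sum.Sigma) (simp_all add: fin)
  also have "\<dots> = (\<Sum>(\<nu>, B)\<in>{p \<in> ?P. insert (snd p) (fst p) = \<mu>}. ?g \<nu> B)"
    by (rule sum.mono_neutral_right[OF finP]) (blast, simp add: case_prod_beta)
  also have "\<dots> = (\<Sum>A\<in>{A \<in> ?R. \<mu> - {A} \<in> ?K}. Poly_Mapping.lookup v (\<mu> - {A}) * qv powi node_deg e A \<mu>)"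
  proof (rule sum.reindex_bij_witness[of _ "\<lambda>A. (\<mu> - {A}, A)" snd], goal_cases)
    case (1 p)
    then show ?case by (auto simp: addable_def)
  next
    case (2 p)
    then show ?case using v by (auto simp: addable_def removable_def)
  next
    case (4 A)
    then show ?case using assms(2) by (auto simp: addable_def removable_def insert_absorb)
  next
    case (5 p)
    then show ?case by (auto simp: addable_def)
  qed auto
  \<comment> \<open>Removable nodes whose removal leaves the support contribute zero.\<close>
  also have "\<dots> = (\<Sum>A\<in>?R. Poly_Mapping.lookup v (\<mu> - {A}) * qv powi node_deg e A \<mu>)"
    by (rule sum.mono_neutral_left[OF finR]) (auto simp: in_keys_iff)
  finally show ?thesis .
qed

lemma keys_f_op:
  assumes "Poly_Mapping.keys v \<subseteq> Collect is_diagram"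
  shows "Poly_Mapping.keys (f_op e i v) \<subseteq> Collect is_diagram"
proof
  fix \<mu> assume \<mu>: "\<mu> \<in> Poly_Mapping.keys (f_op e i v)"
  show "\<mu> \<in> Collect is_diagram"
  proof (rule ccontr)
    assume "\<mu> \<notin> Collect is_diagram"
    then have "insert B \<nu> \<noteq> \<mu>" if "addable \<nu> B" for B \<nu>
      using that by (auto simp: addable_def)
    then have "Poly_Mapping.lookup (f_op e i v) \<mu> = 0"
      by (simp add: f_op_def lookup_sum lookup_fbasis)
    with \<mu> show False by (simp add: in_keys_iff)
  qed
qed

lemma f_op_fscale: "f_op e i (fscale c v) = fscale c (f_op e i v)"
\<comment> \<open>\<open>f_op\<close> sums over the support, which scaling preserves only for
  nonzero \<open>c\<close>.\<close>
proof (cases "c = 0")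
  case True
  have "fscale 0 w = 0" for w by (rule poly_mapping_eqI) simp
  with True show ?thesis by (simp add: f_op_def)
next
  case False
  then have "Poly_Mapping.keys (fscale c v) = Poly_Mapping.keys v"
    by (auto simp: in_keys_iff)
  then show ?thesis
    by (intro poly_mapping_eqI) (simp add: f_op_def lookup_sum sum_distrib_left mult.assoc)
qed

lemma f_op_pow_fscale: "(f_op e i ^^ n) (fscale c v) = fscale c ((f_op e i ^^ n) v)"
  by (induction n) (simp_all add: f_op_fscale)

section \<open>Standard tableaux and the node with the largest label\<close>

lemma tab_deg_snoc: "tab_deg e (ts @ [A]) = tab_deg e ts + node_deg e A (insert A (set ts))"
  by (simp add: tab_deg_def nth_append)

text \<open>The comparison inside \<open>standard_tableaux\<close>, isolated because its maximal
  elements in a diagram are exactly the removable nodes.\<close>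

definition node_before :: "node \<Rightarrow> node \<Rightarrow> bool" where
  "node_before A B \<longleftrightarrow> fst A = fst B \<and> snd A < snd B \<or> snd A = snd B \<and> fst A < fst B"

lemma standard_tableaux_iff:
  "ts \<in> standard_tableaux \<mu> \<longleftrightarrow> distinct ts \<and> set ts = \<mu> \<and>
     (\<forall>i<length ts. \<forall>j<length ts. node_before (ts ! i) (ts ! j) \<longrightarrow> i < j)"
  unfolding standard_tableaux_def node_before_def by (rule mem_Collect_eq)

lemma standard_tableaux_snoc_iff:
  "ts @ [A] \<in> standard_tableaux \<mu> \<longleftrightarrow>
     A \<in> \<mu> \<and> ts \<in> standard_tableaux (\<mu> - {A}) \<and> (\<forall>B\<in>\<mu>. \<not> node_before A B)"
proof -
  have irrefl: "\<not> node_before A A" by (simp add: node_before_def)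
  have "(\<forall>i<length (ts @ [A]). \<forall>j<length (ts @ [A]).
          node_before ((ts @ [A]) ! i) ((ts @ [A]) ! j) \<longrightarrow> i < j) \<longleftrightarrow>
        (\<forall>i<length ts. \<forall>j<length ts. node_before (ts ! i) (ts ! j) \<longrightarrow> i < j) \<and>
        (\<forall>B\<in>set ts. \<not> node_before A B)"
    (is "?L \<longleftrightarrow> ?R")
  proof
    assume L: ?L
    have "i < j" if "i < length ts" "j < length ts" "node_before (ts ! i) (ts ! j)" for i j
      using L[rule_format, of i j] that by (simp add: nth_append)
    moreover have "\<not> node_before A (ts ! j)" if "j < length ts" for j
      using L[rule_format, of "length ts" j] that by (auto simp: nth_append)
    ultimately show ?R unfolding all_set_conv_all_nth by blast
  next
    assume R: ?R
    show ?L
    proof (intro allI impI)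
      fix i j assume ij: "i < length (ts @ [A])" "j < length (ts @ [A])"
        "node_before ((ts @ [A]) ! i) ((ts @ [A]) ! j)"
      consider "i < length ts" "j < length ts" | "i = length ts" "j < length ts"
        | "i < length ts" "j = length ts" | "i = length ts" "j = length ts"
        using ij(1,2) by force
      then show "i < j"
        using ij(3) R irrefl by cases (simp_all add: nth_append)
    qed
  qed
  moreover have "distinct (ts @ [A]) \<and> set (ts @ [A]) = \<mu> \<longleftrightarrow> A \<in> \<mu> \<and> distinct ts \<and> set ts = \<mu> - {A}"
    by auto
  moreover have "(\<forall>B\<in>set ts. \<not> node_before A B) \<longleftrightarrow> (\<forall>B\<in>\<mu>. \<not> node_before A B)"
    if "set ts = \<mu> - {A}"
    using irrefl that by auto
  ultimately show ?thesis
    unfolding standard_tableaux_iff by (metis (no_types, lifting))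
qed

text \<open>If deleting \<open>A\<close> left a gap, then \<open>A = (x', y')\<close> would lie
  weakly above and to the left of another node \<open>(x, y)\<close>. The nodes
  \<open>(x, y')\<close> and \<open>(x', y)\<close> also belong to the diagram, and at least one of
  them comes strictly after \<open>A\<close>.\<close>

lemma removable_iff_no_node_before:
  assumes "is_diagram \<mu>"
  shows "removable \<mu> A \<longleftrightarrow> A \<in> \<mu> \<and> (\<forall>B\<in>\<mu>. \<not> node_before A B)"
proof
  assume "removable \<mu> A"
  then have A: "A \<in> \<mu>" "is_diagram (\<mu> - {A})" by (auto simp: removable_def)
  have pos: "1 \<le> fst A" "1 \<le> snd A" using is_diagram_pos[OF assms, of "fst A" "snd A"] A by auto
  have "\<not> node_before A B" if "B \<in> \<mu>" for B
  proof
    assume *: "node_before A B"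
    then have "(fst B, snd B) \<in> \<mu> - {A}" using that by (auto simp: node_before_def)
    from is_diagramD[OF A(2) this, of "fst A" "snd A"] pos * show False
      by (auto simp: node_before_def)
  qed
  with A show "A \<in> \<mu> \<and> (\<forall>B\<in>\<mu>. \<not> node_before A B)" by blast
next
  assume A: "A \<in> \<mu> \<and> (\<forall>B\<in>\<mu>. \<not> node_before A B)"
  obtain a b where ab: "A = (a, b)" by force
  have "1 \<le> x \<and> 1 \<le> y \<and> (\<forall>x'\<in>{1..x}. \<forall>y'\<in>{1..y}. (x', y') \<in> \<mu> - {A})"
    if B: "(x, y) \<in> \<mu> - {A}" for x y
  proof (intro conjI ballI)
    show "1 \<le> x" "1 \<le> y" using is_diagram_pos[OF assms, of x y] B by auto
    fix x' y' assume xy: "x' \<in> {1..x}" "y' \<in> {1..y}"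
    have mem: "(x', y') \<in> \<mu>" "(x, y') \<in> \<mu>" "(x', y) \<in> \<mu>"
      using is_diagramD[OF assms, of x y] B xy by auto
    have "(x', y') \<noteq> (a, b)"
    proof
      assume eq: "(x', y') = (a, b)"
      have "\<not> node_before A (x, y')" "\<not> node_before A (x', y)" using A mem by blast+
      then show False using eq ab B xy by (auto simp: node_before_def)
    qed
    then show "(x', y') \<in> \<mu> - {A}" using mem ab by blast
  qed
  then have "is_diagram (\<mu> - {A})"
    using is_diagram_finite[OF assms] unfolding is_diagram_def
    by (intro conjI ballI prod.case_eq_if[THEN iffD2]) (simp, (metis prod.collapse)+)
  with A show "removable \<mu> A" by (simp add: removable_def)
qed

lemma standard_tableaux_snoc:
  assumes "is_diagram \<mu>"
  shows "ts @ [A] \<in> standard_tableaux \<mu> \<longleftrightarrow> removable \<mu> A \<and> ts \<in> standard_tableaux (\<mu> - {A})"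
  by (simp only: standard_tableaux_snoc_iff removable_iff_no_node_before[OF assms] conj_ac)

lemma finite_standard_tableaux: "finite (standard_tableaux \<mu>)"
proof (cases "finite \<mu>")
  case True
  have "standard_tableaux \<mu> \<subseteq> {ts. set ts = \<mu> \<and> distinct ts}"
    by (auto simp: standard_tableaux_def)
  also have "finite \<dots>"
    by (rule finite_subset[OF _ finite_lists_length_eq[OF True, of "card \<mu>"]])
      (auto dest: distinct_card)
  finally (finite_subset) show ?thesis .
next
  case False
  then have "standard_tableaux \<mu> = {}" by (auto simp: standard_tableaux_def)
  then show ?thesis by simp
qed

text \<open>Induction on the residues: the last operator adds the node with the largest label, and
  its exponent \<open>node_deg\<close> is exactly the last summand of \<open>tab_deg\<close>. The
  support claim is carried along because \<open>lookup_f_op\<close> requires it.\<close>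

lemma foldl_f_op_vacuum:
  shows "Poly_Mapping.keys (foldl (\<lambda>v i. f_op e i v) (fbasis {}) js) \<subseteq> Collect is_diagram"
    and "is_diagram \<mu> \<Longrightarrow> Poly_Mapping.lookup (foldl (\<lambda>v i. f_op e i v) (fbasis {}) js) \<mu> =
      (\<Sum>ts | ts \<in> standard_tableaux \<mu> \<and> res_seq e ts = js. qv powi tab_deg e ts)"
proof -
  let ?F = "\<lambda>js. foldl (\<lambda>v i. f_op e i v) (fbasis {}) js"
  let ?T = "\<lambda>\<mu> js. {ts. ts \<in> standard_tableaux \<mu> \<and> res_seq e ts = js}"
  have *: "Poly_Mapping.keys (?F js) \<subseteq> Collect is_diagram \<and>
    (\<forall>\<mu>. is_diagram \<mu> \<longrightarrow> Poly_Mapping.lookup (?F js) \<mu> = (\<Sum>ts\<in>?T \<mu> js. qv powi tab_deg e ts))"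
  proof (induction js rule: rev_induct)
    case Nil
    have "?T \<mu> [] = (if \<mu> = {} then {[]} else {})" for \<mu>
      by (auto simp: standard_tableaux_def res_seq_def)
    then show ?case
      by (auto simp: lookup_fbasis tab_deg_def in_keys_iff split: if_splits)
  next
    case (snoc i js)
    have "Poly_Mapping.lookup (f_op e i (?F js)) \<mu> = (\<Sum>ts\<in>?T \<mu> (js @ [i]). qv powi tab_deg e ts)"
      if \<mu>: "is_diagram \<mu>" for \<mu>
    proof -
      let ?R = "{A. removable \<mu> A \<and> res e A = i}"
      have finR: "finite ?R"
        by (rule finite_subset[OF _ is_diagram_finite[OF \<mu>]]) (auto simp: removable_def)
      have finT: "finite (?T \<mu>' js)" for \<mu>'
        by (rule finite_subset[OF _ finite_standard_tableaux]) auto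
      have "Poly_Mapping.lookup (f_op e i (?F js)) \<mu> =
          (\<Sum>A\<in>?R. Poly_Mapping.lookup (?F js) (\<mu> - {A}) * qv powi node_deg e A \<mu>)"
        using snoc.IH \<mu> by (intro lookup_f_op) auto
      also have "\<dots> = (\<Sum>A\<in>?R. \<Sum>ts\<in>?T (\<mu> - {A}) js. qv powi tab_deg e ts * qv powi node_deg e A \<mu>)"
        using snoc.IH by (intro sum.cong) (auto simp: removable_def sum_distrib_right)
      also have "\<dots> = (\<Sum>(A, ts)\<in>Sigma ?R (\<lambda>A. ?T (\<mu> - {A}) js). qv powi tab_deg e ts * qv powi node_deg e A \<mu>)"
        using finR finT by (subst sum.Sigma) auto
      also have "\<dots> = (\<Sum>ts\<in>?T \<mu> (js @ [i]). qv powi tab_deg e ts)"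
      proof (rule sum.reindex_bij_witness[of _ "\<lambda>ts. (last ts, butlast ts)" "\<lambda>(A, ts). ts @ [A]"], goal_cases)
        case (4 us)
        then have "us \<noteq> []" by (auto simp: res_seq_def)
        then show ?case using 4 standard_tableaux_snoc[OF \<mu>, of "butlast us" "last us"]
          by (cases us rule: rev_cases) (auto simp: res_seq_def)
      next
        case (3 us)
        then have "us \<noteq> []" by (auto simp: res_seq_def)
        then show ?case by simp
      next
        case (5 p)
        obtain A ts where "p = (A, ts)" by (cases p)
        then show ?case using 5
          by (auto simp: tab_deg_snoc power_int_add standard_tableaux_def removable_def insert_absorb)
      qed (auto simp: standard_tableaux_snoc[OF \<mu>] res_seq_def)
      finally show ?thesis .
    qed
    then show ?case using keys_f_op[of "?F js"] snoc.IH by auto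
  qed
  from * show "Poly_Mapping.keys (?F js) \<subseteq> Collect is_diagram"
    and "is_diagram \<mu> \<Longrightarrow> Poly_Mapping.lookup (?F js) \<mu> = (\<Sum>ts\<in>?T \<mu> js. qv powi tab_deg e ts)"
    by blast+
qed


section \<open>Ladder weights\<close>

text \<open>Solving for \<open>m\<close> shows that the node determines its ladder, so ladders are
  disjoint. The bound \<open>k * (e - 1) < m\<close>, which keeps the subtraction from truncating,
  becomes \<open>1 \<le> b\<close>.\<close>

lemma mem_ladder_iff: "(a, b) \<in> ladder e m \<longleftrightarrow> 1 \<le> a \<and> 1 \<le> b \<and> m = b + (a - 1) * (e - 1)"
proof
  assume "(a, b) \<in> ladder e m"
  then show "1 \<le> a \<and> 1 \<le> b \<and> m = b + (a - 1) * (e - 1)" by (auto simp: ladder_def)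
next
  assume *: "1 \<le> a \<and> 1 \<le> b \<and> m = b + (a - 1) * (e - 1)"
  then show "(a, b) \<in> ladder e m"
    unfolding ladder_def by (intro CollectI exI[of _ "a - 1"]) auto
qed

text \<open>On a ladder, \<open>m - 1\<close> and \<open>b - a\<close> differ by
  \<open>(a - 1) * e\<close>.\<close>

lemma res_eq_ladder_res:
  assumes "A \<in> ladder e m" "0 < e"
  shows "res e A = ladder_res e m"
proof -
  obtain a b where A: "A = (a, b)" by force
  have *: "1 \<le> a" "1 \<le> b" "m = b + (a - 1) * (e - 1)"
    using assms A mem_ladder_iff by auto
  have "int (m - 1) = int b + int (a - 1) * int (e - 1) - 1" using * by (simp add: of_nat_diff)
  also have "\<dots> = (int b - int a) + (int a - 1) * int e"
    using * assms(2) by (simp only: of_nat_diff) (simp add: of_nat_diff algebra_simps)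
  finally have "int (m - 1) = (int b - int a) + (int a - 1) * int e" .
  then have "int (m - 1) mod int e = (int b - int a) mod int e" by simp
  then show ?thesis by (simp add: res_def ladder_res_def A flip: zmod_int)
qed

text \<open>The ladder weight in block form, ladder by ladder. It depends on the diagram only
  through the ladder sizes, as does the LLT approximation.\<close>

definition ladder_word :: "nat \<Rightarrow> diagram \<Rightarrow> nat \<Rightarrow> nat list" where
  "ladder_word e \<mu> n = concat (map (\<lambda>m. replicate (ladder_size e \<mu> m) (ladder_res e m)) [1..<Suc n])"

lemma ladder_word_0 [simp]: "ladder_word e \<mu> 0 = []"
  by (simp add: ladder_word_def)

lemma ladder_word_Suc [simp]:
  "ladder_word e \<mu> (Suc n) = ladder_word e \<mu> n @ replicate (ladder_size e \<mu> (Suc n)) (ladder_res e (Suc n))"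
  by (simp add: ladder_word_def)

lemma ladder_word_cong:
  assumes "\<And>m. m \<le> n \<Longrightarrow> ladder_size e \<mu> m = ladder_size e \<nu> m"
  shows "ladder_word e \<mu> n = ladder_word e \<nu> n"
  using assms by (induction n) auto

lemma finite_ladders:
  assumes "finite \<mu>" shows "finite {m. ladder_size e \<mu> m \<noteq> 0}"
proof (rule finite_subset)
  show "{m. ladder_size e \<mu> m \<noteq> 0} \<subseteq> (\<lambda>(a, b). b + (a - 1) * (e - 1)) ` \<mu>"
  proof
    fix m assume "m \<in> {m. ladder_size e \<mu> m \<noteq> 0}"
    then have "\<mu> \<inter> ladder e m \<noteq> {}" by (auto simp: ladder_size_def)
    then obtain a b where "(a, b) \<in> \<mu>" "(a, b) \<in> ladder e m" by auto
    then show "m \<in> (\<lambda>(a, b). b + (a - 1) * (e - 1)) ` \<mu>"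
      using mem_ladder_iff by force
  qed
qed (use assms in simp)

lemma ladder_size_gt_last:
  assumes "finite \<mu>" "last_ladder e \<mu> < m" shows "ladder_size e \<mu> m = 0"
proof (rule ccontr)
  assume "ladder_size e \<mu> m \<noteq> 0"
  then have "m \<le> last_ladder e \<mu>"
    unfolding last_ladder_def using finite_ladders[OF assms(1)] by (intro Max_ge) auto
  with assms(2) show False by simp
qed

lemma ladder_word_ge_last:
  assumes "finite \<mu>" "last_ladder e \<mu> \<le> n"
  shows "ladder_word e \<mu> n = ladder_word e \<mu> (last_ladder e \<mu>)"
  using assms(2) by (induction n rule: dec_induct) (simp_all add: ladder_size_gt_last[OF assms(1)])

lemma last_ladder_nonempty:
  assumes "finite \<mu>" "\<mu> \<subseteq> {1..} \<times> {1..}" "\<mu> \<noteq> {}"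
  shows "0 < last_ladder e \<mu>" "\<mu> \<inter> ladder e (last_ladder e \<mu>) \<noteq> {}"
proof -
  obtain a b where ab: "(a, b) \<in> \<mu>" using assms(3) by auto
  define m where "m = b + (a - 1) * (e - 1)"
  have "(a, b) \<in> \<mu> \<inter> ladder e m" using ab assms(2) by (auto simp: mem_ladder_iff m_def)
  then have "ladder_size e \<mu> m \<noteq> 0" using assms(1) by (auto simp: ladder_size_def)
  moreover have "0 < m" using ab assms(2) by (auto simp: m_def)
  ultimately show pos: "0 < last_ladder e \<mu>"
    using ladder_size_gt_last[OF assms(1), of e m] by (meson not_less order.strict_trans2)
  have "last_ladder e \<mu> \<in> insert 0 {m. ladder_size e \<mu> m \<noteq> 0}"
    unfolding last_ladder_def using finite_ladders[OF assms(1)] by (intro Max_in) auto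
  with pos show "\<mu> \<inter> ladder e (last_ladder e \<mu>) \<noteq> {}" by (auto simp: ladder_size_def)
qed

text \<open>Deleting a node of the last ladder removes one letter from the last block and changes no
  other block. The claim concerns finite sets of nodes with positive coordinates, so the induction
  does not have to show that the remainder is a diagram.\<close>

lemma ladder_weight_aux_eq:
  assumes "0 < e" "finite \<mu>" "\<mu> \<subseteq> {1..} \<times> {1..}" "card \<mu> = n"
  shows "ladder_weight_aux e n \<mu> = ladder_word e \<mu> (last_ladder e \<mu>)"
  using assms(2-)
proof (induction n arbitrary: \<mu>)
  case 0
  then have "last_ladder e \<mu> = 0" by (simp add: last_ladder_def ladder_size_def)
  then show ?case by simp
next
  case (Suc n)
  let ?A = "bottom_seq_last e \<mu>"
  let ?\<nu> = "\<mu> - {?A}"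
  have "\<mu> \<noteq> {}" using Suc.prems by auto
  note last = last_ladder_nonempty[OF Suc.prems(1,2) this, of e]
  have A: "?A \<in> \<mu> \<inter> ladder e (last_ladder e \<mu>)"
    unfolding bottom_seq_last_def using last(2) arg_min_natI[of "\<lambda>A. A \<in> \<mu> \<inter> ladder e (last_ladder e \<mu>)"]
    by blast
  obtain t where t: "last_ladder e \<mu> = Suc t" using last(1) by (cases "last_ladder e \<mu>") auto
  have A_unique: "m = Suc t" if "?A \<in> ladder e m" for m
    using that A t by (metis IntD2 mem_ladder_iff prod.collapse)
  have size_other: "ladder_size e ?\<nu> m = ladder_size e \<mu> m" if "m \<noteq> Suc t" for m
  proof -
    have "?\<nu> \<inter> ladder e m = \<mu> \<inter> ladder e m" using A_unique[of m] that by auto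
    then show ?thesis by (simp add: ladder_size_def)
  qed
  have "\<mu> \<inter> ladder e (Suc t) = insert ?A (?\<nu> \<inter> ladder e (Suc t))" using A t by auto
  then have size_last: "ladder_size e \<mu> (Suc t) = Suc (ladder_size e ?\<nu> (Suc t))"
    unfolding ladder_size_def using Suc.prems(1) by simp
  have "last_ladder e ?\<nu> \<le> Suc t"
  proof (rule ccontr)
    assume gt: "\<not> last_ladder e ?\<nu> \<le> Suc t"
    have "last_ladder e ?\<nu> \<in> insert 0 {m. ladder_size e ?\<nu> m \<noteq> 0}"
      unfolding last_ladder_def using finite_ladders[of ?\<nu> e] Suc.prems(1) by (intro Max_in) auto
    with gt have "ladder_size e ?\<nu> (last_ladder e ?\<nu>) \<noteq> 0" by auto
    moreover have "ladder_size e \<mu> (last_ladder e ?\<nu>) = 0"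
      using gt t by (intro ladder_size_gt_last[OF Suc.prems(1)]) simp
    ultimately show False using size_other[of "last_ladder e ?\<nu>"] gt by simp
  qed
  \<comment> \<open>If the deleted node was alone in its ladder, the last ladder moves down; the
    words still agree because the blocks in between are empty.\<close>
  then have "ladder_word e ?\<nu> (last_ladder e ?\<nu>) = ladder_word e ?\<nu> (Suc t)"
    using Suc.prems(1) by (intro ladder_word_ge_last[symmetric]) simp_all
  moreover have "ladder_word e ?\<nu> t = ladder_word e \<mu> t"
    by (rule ladder_word_cong) (simp add: size_other)
  moreover have "ladder_weight_aux e n ?\<nu> = ladder_word e ?\<nu> (last_ladder e ?\<nu>)"
    using Suc.prems A by (intro Suc.IH) auto
  moreover have "res e ?A = ladder_res e (Suc t)"
    using A t assms(1) by (intro res_eq_ladder_res) auto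
  ultimately show ?case
    by (simp add: t size_last Let_def replicate_append_same)
qed

lemma ladder_weight_eq:
  assumes "0 < e" "is_diagram \<mu>"
  shows "ladder_weight e \<mu> = ladder_word e \<mu> (last_ladder e \<mu>)"
  unfolding ladder_weight_def
proof (rule ladder_weight_aux_eq[OF assms(1)])
  show "\<mu> \<subseteq> {1..} \<times> {1..}" using is_diagram_pos[OF assms(2)] by auto
qed (simp_all add: is_diagram_finite[OF assms(2)])

lemma length_ladder_weight_aux: "length (ladder_weight_aux e n \<mu>) = n"
  by (induction n arbitrary: \<mu>) (simp_all add: Let_def)

lemma res_less: "0 < e \<Longrightarrow> res e A < e"
  by (simp add: res_def nat_less_iff)

lemma set_ladder_weight_aux: "0 < e \<Longrightarrow> set (ladder_weight_aux e n \<mu>) \<subseteq> {..<e}"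
  by (induction n arbitrary: \<mu>) (simp_all add: Let_def res_less)

lemma ladder_weight_in_weights:
  "0 < e \<Longrightarrow> \<mu> \<in> partitions_of d \<Longrightarrow> ladder_weight e \<mu> \<in> weights e d"
  by (simp add: weights_def ladder_weight_def length_ladder_weight_aux set_ladder_weight_aux partitions_of_def)

section \<open>Quantum factorials and divided powers\<close>

lemma qv_power: "qv ^ n = Fract ([:0, 1:] ^ n) 1"
  by (induction n) (simp_all add: qv_def One_fract_def)

lemma qv_power_neq_1: "0 < n \<Longrightarrow> qv ^ n \<noteq> 1"
proof
  assume "0 < n" "qv ^ n = 1"
  then have "[:0, 1::rat:] ^ n = 1" by (simp add: qv_power One_fract_def eq_fract)
  then have "poly ([:0, 1::rat:] ^ n) 0 = 1" by simp
  with \<open>0 < n\<close> show False by (simp add: zero_power)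
qed

lemma qv_power_neq_inverse: "0 < n \<Longrightarrow> qv ^ n \<noteq> inverse (qv ^ n)"
proof
  assume "0 < n" and eq: "qv ^ n = inverse (qv ^ n)"
  have "qv ^ (n + n) = qv ^ n * inverse (qv ^ n)" by (subst eq[symmetric]) (rule power_add)
  also have "\<dots> = 1" by simp
  finally show False using qv_power_neq_1[of "n + n"] \<open>0 < n\<close> by simp
qed

text \<open>Because \<open>q\<close> is not a root of unity, neither \<open>q^k - q^-k\<close> nor
  the denominator \<open>q - q^-1\<close> vanishes; the denominator has to be checked since division
  by zero yields zero.\<close>

lemma qfact_nonzero: "qfact n \<noteq> 0"
proof -
  have "qint k \<noteq> 0" if "0 < k" for k
    using qv_power_neq_inverse[OF that] qv_power_neq_inverse[of 1]
    by (simp add: qint_def power_int_minus)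
  then show ?thesis by (auto simp: qfact_def)
qed

lemma foldl_f_op_replicate: "foldl (\<lambda>v i. f_op e i v) v (replicate r c) = (f_op e c ^^ r) v"
  by (induction r arbitrary: v) (simp_all add: funpow_swap1)

lemma foldl_f_div_eq:
  "fscale (\<Prod>m=1..n. qfact (ladder_size e \<mu> m))
     (foldl (\<lambda>v m. f_div e (ladder_res e m) (ladder_size e \<mu> m) v) v [1..<Suc n]) =
   foldl (\<lambda>v i. f_op e i v) v (ladder_word e \<mu> n)"
proof (induction n)
  case (Suc n)
  let ?w = "foldl (\<lambda>v m. f_div e (ladder_res e m) (ladder_size e \<mu> m) v) v [1..<Suc n]"
  let ?P = "\<Prod>m=1..n. qfact (ladder_size e \<mu> m)"
  let ?r = "ladder_size e \<mu> (Suc n)" and ?f = "f_op e (ladder_res e (Suc n))"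
  have "fscale (\<Prod>m=1..Suc n. qfact (ladder_size e \<mu> m)) (f_div e (ladder_res e (Suc n)) ?r ?w) =
      fscale ?P ((?f ^^ ?r) ?w)"
    by (simp add: f_div_def fscale_fscale qfact_nonzero mult.assoc del: upt_Suc)
  also have "\<dots> = (?f ^^ ?r) (fscale ?P ?w)" by (simp only: f_op_pow_fscale)
  finally show ?case using Suc.IH by (simp add: foldl_f_op_replicate)
qed simp_all

lemma r_factor_LLT_approx:
  assumes "0 < e" "is_diagram \<kappa>"
  shows "fscale (r_factor e \<kappa>) (LLT_approx e \<kappa>) =
    foldl (\<lambda>v i. f_op e i v) (fbasis {}) (ladder_weight e \<kappa>)"
  unfolding r_factor_def LLT_approx_def ladder_weight_eq[OF assms] by (rule foldl_f_div_eq)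


section \<open>Linear independence modulo \<open>q\<close>\<close>

lemma Fract_sum: "(\<Sum>x\<in>X. Fract (f x) 1) = Fract (\<Sum>x\<in>X. f x) (1 :: 'a :: idom)"
  by (induction X rule: infinite_finite_induct) (simp_all add: Zero_fract_def)

text \<open>Replaces rational coefficients by polynomials, for which divisibility by
  \<open>q\<close> makes sense.\<close>

lemma common_denominator:
  fixes c :: "'b \<Rightarrow> 'a::idom fract"
  assumes "finite J"
  obtains Q P where "Q \<noteq> 0" "\<And>\<nu>. \<nu> \<in> J \<Longrightarrow> c \<nu> * Fract Q 1 = Fract (P \<nu>) 1"
proof -
  have "\<exists>Q. Q \<noteq> 0 \<and> (\<forall>\<nu>\<in>J. \<exists>P. c \<nu> * Fract Q 1 = Fract P 1)"
    using assms
  proof induction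
    case empty
    then show ?case by (intro exI[of _ 1]) simp
  next
    case (insert \<mu> J)
    then obtain Q where Q: "Q \<noteq> 0" "\<forall>\<nu>\<in>J. \<exists>P. c \<nu> * Fract Q 1 = Fract P 1" by blast
    obtain a s where as: "c \<mu> = Fract a s" "s \<noteq> 0" by (cases "c \<mu>")
    have *: "Fract (Q * s) 1 = Fract Q 1 * Fract s 1" by simp
    have "\<exists>P. c \<nu> * Fract (Q * s) 1 = Fract P 1" if \<nu>: "\<nu> \<in> insert \<mu> J" for \<nu>
    proof (cases "\<nu> = \<mu>")
      case True
      have "c \<mu> * Fract (Q * s) 1 = Fract (a * Q) 1" using as by (simp add: eq_fract)
      with True show ?thesis by blast
    next
      case False
      then obtain P where "c \<nu> * Fract Q 1 = Fract P 1" using \<nu> Q by blast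
      then have "c \<nu> * Fract (Q * s) 1 = Fract (P * s) 1"
        by (simp only: * flip: mult.assoc) simp
      then show ?thesis by blast
    qed
    then show ?case using Q as by (intro exI[of _ "Q * s"]) simp
  qed
  then show ?thesis using that by metis
qed

text \<open>\<open>qv\<close> is the class of the indeterminate, so evaluation at it is the
  embedding into the fraction field. Membership in \<open>q_poly_ideal\<close> thereby becomes
  divisibility of a polynomial by \<open>q\<close>.\<close>

lemma poly_qv: "poly (map_poly of_int p) qv = Fract (map_poly of_int p) 1"
proof (induction p)
  case 0
  then show ?case by (simp add: Zero_fract_def)
next
  case (pCons a p)
  have "(of_int a :: ratfun) = Fract [:of_int a:] 1"
  proof (induction a rule: int_induct[of _ 0])
    case base
    show ?case by (simp add: Zero_fract_def)
  next
    case (step1 i)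
    then show ?case by (simp add: One_fract_def add.commute one_pCons)
  next
    case (step2 i)
    then show ?case by (simp add: One_fract_def one_pCons)
  qed
  with pCons show ?case by (simp add: map_poly_pCons qv_def)
qed

lemma q_poly_ideal_Fract: "x \<in> q_poly_ideal \<Longrightarrow> \<exists>R. x = Fract ([:0, 1:] * R) 1"
  unfolding q_poly_ideal_def poly_qv by (auto simp: qv_def simp del: mult_pCons_left)

text \<open>A relation forces every numerator to be divisible by arbitrarily high powers of \<open>q\<close>.\<close>

lemma unitriangular_mod_q_independent:
  fixes c :: "'b \<Rightarrow> ratfun"
  assumes fin: "finite J"
    and M: "\<And>\<mu> \<nu>. \<mu> \<in> J \<Longrightarrow> \<nu> \<in> J \<Longrightarrow> M \<mu> \<nu> - (if \<mu> = \<nu> then 1 else 0) \<in> q_poly_ideal"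
    and rel: "\<And>\<mu>. \<mu> \<in> J \<Longrightarrow> (\<Sum>\<nu>\<in>J. c \<nu> * M \<mu> \<nu>) = 0"
    and "\<nu> \<in> J"
  shows "c \<nu> = 0"
proof -
  let ?X = "[:0, 1:] :: rat poly"
  obtain Q P where Q: "Q \<noteq> 0" and P: "\<And>\<nu>. \<nu> \<in> J \<Longrightarrow> c \<nu> * Fract Q 1 = Fract (P \<nu>) 1"
    using common_denominator[OF fin, of c] by metis
  have "\<exists>R. \<forall>\<mu>\<in>J. \<forall>\<nu>\<in>J. M \<mu> \<nu> - (if \<mu> = \<nu> then 1 else 0) = Fract (?X * R \<mu> \<nu>) 1"
    using q_poly_ideal_Fract[OF M] by metis
  then obtain R where R: "\<And>\<mu> \<nu>. \<mu> \<in> J \<Longrightarrow> \<nu> \<in> J \<Longrightarrow>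
      M \<mu> \<nu> = (if \<mu> = \<nu> then 1 else 0) + Fract (?X * R \<mu> \<nu>) 1"
    by (metis add.commute diff_add_cancel)
  \<comment> \<open>Row \<open>\<mu>\<close> of the relation times the common denominator: the
    identity part of \<open>M\<close> isolates \<open>P \<mu>\<close>, and everything else carries a
    factor \<open>q\<close>.\<close>
  have step: "P \<mu> = - (?X * (\<Sum>\<nu>\<in>J. P \<nu> * R \<mu> \<nu>))" if \<mu>: "\<mu> \<in> J" for \<mu>
  proof -
    have "0 = (\<Sum>\<nu>\<in>J. c \<nu> * M \<mu> \<nu>) * Fract Q 1" by (simp add: rel[OF \<mu>])
    also have "\<dots> = (\<Sum>\<nu>\<in>J. Fract (P \<nu>) 1 * ((if \<mu> = \<nu> then 1 else 0) + Fract (?X * R \<mu> \<nu>) 1))"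
      unfolding sum_distrib_right
    proof (rule sum.cong[OF refl])
      fix \<nu> assume \<nu>: "\<nu> \<in> J"
      have "c \<nu> * M \<mu> \<nu> * Fract Q 1 = (c \<nu> * Fract Q 1) * M \<mu> \<nu>" by (simp only: ac_simps)
      then show "c \<nu> * M \<mu> \<nu> * Fract Q 1 =
          Fract (P \<nu>) 1 * ((if \<mu> = \<nu> then 1 else 0) + Fract (?X * R \<mu> \<nu>) 1)"
        by (simp only: P[OF \<nu>] R[OF \<mu> \<nu>])
    qed
    also have "\<dots> = (\<Sum>\<nu>\<in>J. (if \<mu> = \<nu> then Fract (P \<nu>) 1 else 0) + Fract (?X * (P \<nu> * R \<mu> \<nu>)) 1)"
      by (intro sum.cong refl)
        (simp add: distrib_left mult.left_commute del: mult_pCons_left mult_pCons_right)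
    also have "\<dots> = Fract (P \<mu>) 1 + Fract (?X * (\<Sum>\<nu>\<in>J. P \<nu> * R \<mu> \<nu>)) 1"
      using fin \<mu> by (simp add: sum.distrib Fract_sum sum_distrib_left del: mult_pCons_left)
    finally have "P \<mu> + ?X * (\<Sum>\<nu>\<in>J. P \<nu> * R \<mu> \<nu>) = 0"
      by (simp add: Zero_fract_def eq_fract del: mult_pCons_left)
    then show ?thesis by (simp add: add_eq_0_iff2)
  qed
  have dvd: "\<forall>\<nu>\<in>J. ?X ^ n dvd P \<nu>" for n
  proof (induction n)
    case (Suc n)
    show ?case
    proof
      fix \<mu> assume \<mu>: "\<mu> \<in> J"
      have "?X ^ n dvd (\<Sum>\<nu>\<in>J. P \<nu> * R \<mu> \<nu>)"
        by (rule dvd_sum) (use Suc in \<open>simp add: dvd_mult2\<close>)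
      then have "?X * ?X ^ n dvd ?X * (\<Sum>\<nu>\<in>J. P \<nu> * R \<mu> \<nu>)" by (intro mult_dvd_mono dvd_refl)
      then show "?X ^ Suc n dvd P \<mu>" unfolding step[OF \<mu>] by (simp only: dvd_minus_iff power_Suc)
    qed
  qed simp
  have "P \<nu> = 0"
  proof (rule ccontr)
    assume "P \<nu> \<noteq> 0"
    then have "degree (?X ^ Suc (degree (P \<nu>))) \<le> degree (P \<nu>)"
      using dvd \<open>\<nu> \<in> J\<close> by (intro dvd_imp_degree_le) blast+
    then show False by (simp add: degree_power_eq del: power_Suc)
  qed
  then have "c \<nu> * Fract Q 1 = 0" using P[OF \<open>\<nu> \<in> J\<close>] by (simp add: Zero_fract_def)
  moreover have "Fract Q 1 \<noteq> 0" using Q by (simp add: Zero_fract_def eq_fract)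
  ultimately show ?thesis by simp
qed


section \<open>Graded characters\<close>

text \<open>Cancelling the smaller power would leave exponent \<open>b - a\<close> strictly between
  0 and \<open>e\<close> with value 1. Distinct residues therefore give distinct eigenvalues of a
  Jucys-Murphy element.\<close>

lemma power_inj_primitive_root:
  fixes \<xi> :: "'k::field"
  assumes "primitive_root_of_unity e \<xi>" "0 < e"
  shows "inj_on ((^) \<xi>) {..<e}"
proof -
  have "\<xi> \<noteq> 0" using assms by (auto simp: primitive_root_of_unity_def zero_power)
  have less: "\<xi> ^ a \<noteq> \<xi> ^ b" if "a < b" "b < e" for a b
  proof
    assume eq: "\<xi> ^ a = \<xi> ^ b"
    have "\<xi> ^ b = \<xi> ^ a * \<xi> ^ (b - a)" using that by (simp flip: power_add)
    with eq have "\<xi> ^ (b - a) = 1" using \<open>\<xi> \<noteq> 0\<close> by simp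
    with assms that show False by (auto simp: primitive_root_of_unity_def)
  qed
  show ?thesis
  proof (rule inj_onI)
    fix a b assume *: "a \<in> {..<e}" "b \<in> {..<e}" "\<xi> ^ a = \<xi> ^ b"
    then show "a = b" using less[of a b] less[of b a] by (cases a b rule: linorder_cases) auto
  qed
qed

lemma finite_weights: "finite (weights e d)"
  unfolding weights_def by (rule finite_subset[OF _ finite_lists_length_eq[of "{..<e}" d]]) auto

lemma weights_nth: "j \<in> weights e d \<Longrightarrow> s < d \<Longrightarrow> j ! s \<in> {..<e}"
  unfolding weights_def using nth_mem by blast

context ambient_space
begin

section \<open>Maps that are linear on a subspace\<close>

lemma lin_mapD:
  assumes "lin_map U W \<phi>" "v \<in> U"
  shows "\<phi> v \<in> W" "w \<in> U \<Longrightarrow> \<phi> (v + w) = \<phi> v + \<phi> w" "\<phi> (c *s v) = c *s \<phi> v"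
  using assms by (simp_all add: lin_map_def)

lemma lin_map_0: "lin_map U W \<phi> \<Longrightarrow> subspace U \<Longrightarrow> \<phi> 0 = 0"
  using lin_mapD(3)[of U W \<phi> 0 0] subspace_0 by simp

lemma lin_map_diff:
  assumes "lin_map U W \<phi>" "subspace U" "v \<in> U" "w \<in> U"
  shows "\<phi> (v - w) = \<phi> v - \<phi> w"
  using lin_mapD(2)[OF assms(1), of "v - w" w] assms subspace_diff[OF assms(2-4)] by simp

lemma lin_map_sum:
  assumes "lin_map U W \<phi>" "subspace U" "\<And>x. x \<in> A \<Longrightarrow> f x \<in> U"
  shows "\<phi> (\<Sum>x\<in>A. f x) = (\<Sum>x\<in>A. \<phi> (f x))"
  using assms(3)
proof (induction A rule: infinite_finite_induct)
  case (insert x A)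
  then show ?case
    using lin_mapD(2)[OF assms(1), of "f x" "\<Sum>x\<in>A. f x"] subspace_sum[OF assms(2), of A f] by simp
qed (simp_all add: lin_map_0[OF assms(1,2)])

text \<open>Rank-nullity for a map that is linear only on \<open>U\<close>. A basis of
  \<open>U\<close> extending a basis of the kernel defines a globally linear \<open>g\<close>
  agreeing with \<open>\<phi>\<close> on \<open>U\<close>, and the basis vectors outside
  \<open>BK\<close> are carried to a basis of the image.\<close>

lemma dim_kernel_image:
  assumes "lin_map U W \<phi>" and U: "subspace U" and fin: "finite F" "U \<subseteq> span F"
  shows "dim U = dim {v \<in> U. \<phi> v = 0} + dim (\<phi> ` U)"
proof -
  interpret vs: vector_space_pair scale scale ..
  let ?K = "{v \<in> U. \<phi> v = 0}"
  have K: "subspace ?K"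
    using U lin_map_0[OF assms(1) U] lin_mapD[OF assms(1)]
    by (intro subspaceI) (auto simp: subspace_0 subspace_add subspace_scale)
  obtain BK where BK: "BK \<subseteq> ?K" "independent BK" "?K \<subseteq> span BK" "card BK = dim ?K"
    using basis_exists[of ?K] by blast
  obtain B where B: "BK \<subseteq> B" "B \<subseteq> U" "independent B" "U \<subseteq> span B"
    using maximal_independent_subset_extend[of BK U] BK by blast
  have spanB: "span B = U" using B U by (simp add: span_subspace)
  have spanBK: "span BK = ?K" using BK K by (simp add: span_subspace)
  have finB: "finite B" using independent_span_bound[OF fin(1) B(3)] B(2) fin(2) by blast
  obtain g where g: "Vector_Spaces.linear scale scale g" "\<forall>x\<in>B. g x = \<phi> x"
    using vs.linear_independent_extend[OF B(3)] by blast
  interpret g: Vector_Spaces.linear scale scale g by (rule g(1))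
  have g_eq: "g v = \<phi> v" if "v \<in> U" for v
  proof -
    have "v \<in> span B" using that spanB by simp
    then have "v \<in> U \<and> g v = \<phi> v"
    proof (induction rule: span_induct_alt)
      case base
      then show ?case using U lin_map_0[OF assms(1) U] by (simp add: subspace_0)
    next
      case (step c x y)
      have "x \<in> U" using step.hyps B(2) by blast
      then show ?case
        using step U g(2) lin_mapD(2,3)[OF assms(1)]
        by (simp add: g.add g.scale subspace_add subspace_scale)
    qed
    then show ?thesis ..
  qed
  let ?C = "B - BK"
  have spanC: "span ?C \<subseteq> U" using span_mono[of ?C B] spanB by blast
  have inj: "inj_on g (span ?C)"
  proof (subst g.inj_on_iff_eq_0[OF subspace_span], intro ballI impI)
    fix v assume v: "v \<in> span ?C" "g v = 0"
    then have vK: "v \<in> span BK" using spanC g_eq spanBK by auto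
    \<comment> \<open>The coordinates of \<open>v\<close> with respect to \<open>B\<close> are
      supported both on \<open>?C\<close> and on the disjoint set \<open>BK\<close>.\<close>
    have "representation B v = representation ?C v" "representation B v = representation BK v"
      using representation_extend[OF B(3) v(1)] representation_extend[OF B(3) vK] B(1) by auto
    then have "representation B v b = 0" for b
      using representation_ne_zero[of ?C v b] representation_ne_zero[of BK v b] by fastforce
    then show "v = 0"
      using sum_nonzero_representation_eq[OF B(3), of v] v(1) spanC spanB by auto
  qed
  have indep: "independent (g ` ?C)"
    using inj independent_mono[OF B(3), of ?C] by (intro g.independent_injective_image) auto
  have image: "\<phi> ` U = span (g ` ?C)"
  proof -
    have "\<phi> ` U = g ` span B" using g_eq spanB by auto
    also have "\<dots> = span (g ` B)" by (rule g.span_image[symmetric])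
    also have "\<dots> = span (g ` ?C)"
    proof (rule antisym)
      have "g ` B \<subseteq> span (g ` ?C)"
      proof
        fix y assume "y \<in> g ` B"
        then obtain x where x: "x \<in> B" "y = g x" by blast
        show "y \<in> span (g ` ?C)"
        proof (cases "x \<in> BK")
          case True
          then have "y = 0" using x BK(1) g(2) by auto
          then show ?thesis by (simp add: span_zero)
        qed (use x in \<open>auto intro: span_base\<close>)
      qed
      then show "span (g ` B) \<subseteq> span (g ` ?C)" by (simp add: span_minimal)
      show "span (g ` ?C) \<subseteq> span (g ` B)" by (rule span_mono) auto
    qed
    finally show ?thesis .
  qed
  have "dim (\<phi> ` U) = card (g ` ?C)"
    unfolding image by (rule dim_span_eq_card_independent[OF indep])
  also have "\<dots> = card ?C"
    using inj by (intro card_image) (meson inj_on_subset span_superset)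
  finally have "dim (\<phi> ` U) = card B - card BK"
    using B(1) finB by (simp add: card_Diff_subset finite_subset)
  moreover have "dim U = card B" using B by (simp add: basis_card_eq_dim)
  moreover have "card BK \<le> card B" using B(1) finB by (rule card_mono[rotated])
  ultimately show ?thesis using BK(4) by simp
qed

text \<open>The finite spanning set excludes infinite-dimensional spaces, for which
  \<open>dim\<close> takes the value 0 as well.\<close>

lemma dim_eq_0_subset:
  assumes "finite F" "U \<subseteq> span F" "dim U = 0"
  shows "U \<subseteq> {0}"
proof -
  obtain B where B: "B \<subseteq> U" "independent B" "U \<subseteq> span B" "card B = dim U"
    using basis_exists[of U] by blast
  have "finite B" using independent_span_bound[OF assms(1) B(2)] B(1) assms(2) by blast
  then have "B = {}" using B(4) assms(3) by simp
  then show ?thesis using B(3) by simp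
qed


subsection \<open>Generalized eigenvectors\<close>

abbreviation shifted :: "('b \<Rightarrow> 'b) \<Rightarrow> 'a \<Rightarrow> 'b \<Rightarrow> 'b" where
  "shifted X c \<equiv> (\<lambda>u. X u - c *s u)"

lemma lin_map_shifted:
  assumes "lin_map V V X" "subspace V"
  shows "lin_map V V (shifted X c)"
  using assms lin_mapD[OF assms(1)]
  by (simp add: lin_map_def subspace_diff subspace_scale scale_right_distrib scale_right_diff_distrib
      mult.commute)

lemma lin_map_funpow:
  assumes "lin_map V V f" shows "lin_map V V (f ^^ n)"
  using assms by (induction n) (simp_all add: lin_map_def)

lemma shifted_commute:
  assumes "lin_map V V X" "subspace V" "v \<in> V"
  shows "(shifted X a ^^ n) (shifted X b v) = shifted X b ((shifted X a ^^ n) v)"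
proof (induction n)
  case (Suc n)
  have comm: "shifted X a (shifted X b u) = shifted X b (shifted X a u)" if "u \<in> V" for u
  proof -
    have "X (shifted X c u) = X (X u) - c *s X u" for c
      using that assms(2) lin_mapD[OF assms(1)] lin_map_diff[OF assms(1,2), of "X u" "c *s u"]
      by (simp add: subspace_scale)
    then show ?thesis by (simp add: scale_right_diff_distrib scale_left_commute[of a b])
  qed
  have "(shifted X a ^^ n) v \<in> V"
    using lin_mapD(1)[OF lin_map_funpow[OF lin_map_shifted[OF assms(1,2)]] assms(3)] .
  from comm[OF this] Suc show ?case by simp
qed simp

lemma subspace_generalized_eigenspace:
  assumes X: "lin_map V V X" and V: "subspace V"
  shows "subspace {v \<in> V. \<exists>n. (shifted X c ^^ n) v = 0}"
proof (rule subspaceI)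
  note pow = lin_map_funpow[OF lin_map_shifted[OF X V, of c]]
  show "0 \<in> {v \<in> V. \<exists>n. (shifted X c ^^ n) v = 0}"
    using V by (auto simp: subspace_0 intro!: exI[of _ 0])
  fix v assume v: "v \<in> {v \<in> V. \<exists>n. (shifted X c ^^ n) v = 0}"
  then obtain n where n: "(shifted X c ^^ n) v = 0" by blast
  show "a *s v \<in> {v \<in> V. \<exists>n. (shifted X c ^^ n) v = 0}" for a
    using v n lin_mapD(3)[OF pow, of v n a] V by (auto simp: subspace_scale intro!: exI[of _ n])
  fix w assume w: "w \<in> {v \<in> V. \<exists>n. (shifted X c ^^ n) v = 0}"
  then obtain m where m: "(shifted X c ^^ m) w = 0" by blast
  have "(shifted X c ^^ (m + n)) v = 0" "(shifted X c ^^ (n + m)) w = 0"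
    using n m lin_map_0[OF pow V] by (simp_all add: funpow_add)
  then have "(shifted X c ^^ (n + m)) (v + w) = 0"
    using v w lin_mapD(2)[OF pow, of v w "n + m"] by (simp add: add.commute)
  then show "v + w \<in> {v \<in> V. \<exists>n. (shifted X c ^^ n) v = 0}"
    using v w V by (auto simp: subspace_add intro!: exI[of _ "n + m"])
qed

lemma invariant_subspace_eigencomponents:
  assumes X: "lin_map V V X" and V: "subspace V"
    and N: "subspace N" "N \<subseteq> V" "\<And>v. v \<in> N \<Longrightarrow> X v \<in> N"
    and fin: "finite A" and inj: "inj_on a A"
    and w: "\<And>k. k \<in> A \<Longrightarrow> w k \<in> V" "\<And>k. k \<in> A \<Longrightarrow> \<exists>n. (shifted X (a k) ^^ n) (w k) = 0"
    and sum: "(\<Sum>k\<in>A. w k) \<in> N" and "k \<in> A"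
  shows "w k \<in> N"
proof -
  \<comment> \<open>Induction on the total nilpotency order: applying \<open>X - a\<^sub>l\<close> to the sum lowers it, and
    \<open>(X - a\<^sub>k) w\<^sub>k\<close> and \<open>(X - a\<^sub>l) w\<^sub>k\<close> differ by a nonzero multiple of \<open>w\<^sub>k\<close>.\<close>
  obtain n where "\<And>k. k \<in> A \<Longrightarrow> (shifted X (a k) ^^ n k) (w k) = 0" using w(2) by metis
  with w(1) sum \<open>k \<in> A\<close> show ?thesis
  proof (induction "\<Sum>k\<in>A. n k" arbitrary: w n k rule: less_induct)
    case less
    note lin = lin_map_shifted[OF X V]
    have zero: "w j = 0" if "j \<in> A" "n j = 0" for j
      using less.prems(4)[OF that(1)] that(2) by simp
    have reduce: "shifted X (a l) (w k) \<in> N" if l: "l \<in> A" "0 < n l" for l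
    proof (rule less.hyps[where w = "\<lambda>j. shifted X (a l) (w j)" and n = "n(l := n l - 1)"])
      show "(\<Sum>j\<in>A. (n(l := n l - 1)) j) < (\<Sum>j\<in>A. n j)"
        using l fin by (intro sum_strict_mono_ex1) auto
      show "shifted X (a l) (w j) \<in> V" if "j \<in> A" for j
        using lin_mapD(1)[OF lin] less.prems(1) that by blast
      have "(\<Sum>j\<in>A. shifted X (a l) (w j)) = shifted X (a l) (\<Sum>j\<in>A. w j)"
        using less.prems(1) by (rule lin_map_sum[OF lin V, symmetric])
      then show "(\<Sum>j\<in>A. shifted X (a l) (w j)) \<in> N"
        using less.prems(2) N by (simp add: subspace_diff subspace_scale)
      show "k \<in> A" by fact
      fix j assume j: "j \<in> A"
      \<comment> \<open>Applying \<open>X - a l\<close> uses up one order of \<open>w l\<close>; for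
        the other indices the shifts commute, so the old order still suffices.\<close>
      show "(shifted X (a j) ^^ (n(l := n l - 1)) j) (shifted X (a l) (w j)) = 0"
      proof (cases "j = l")
        case True
        have "(shifted X (a l) ^^ (n l - 1)) (shifted X (a l) (w l)) = (shifted X (a l) ^^ Suc (n l - 1)) (w l)"
          by (simp only: funpow_Suc_right o_apply)
        then show ?thesis using less.prems(4)[OF l(1)] l(2) True by simp
      next
        case False
        have "(shifted X (a j) ^^ n j) (shifted X (a l) (w j)) = shifted X (a l) 0"
          using shifted_commute[OF X V less.prems(1)[OF j], where a = "a j" and n = "n j" and b = "a l"] less.prems(4)[OF j] by simp
        then show ?thesis using False lin_map_0[OF lin V] by simp
      qed
    qed
    show ?case
    \<comment> \<open>If no such \<open>l\<close> exists, either \<open>w k\<close> is zero or it is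
      the only possibly nonzero summand and hence equals the given sum.\<close>
    proof (cases "\<exists>l\<in>A. l \<noteq> k \<and> 0 < n l \<and> 0 < n k")
      case True
      then obtain l where l: "l \<in> A" "l \<noteq> k" "0 < n l" "0 < n k" by blast
      have "shifted X (a k) (w k) - shifted X (a l) (w k) \<in> N"
        using subspace_diff[OF N(1) reduce reduce, of k l] l less.prems(3) by blast
      also have "shifted X (a k) (w k) - shifted X (a l) (w k) = (a l - a k) *s w k"
        by (simp add: scale_left_diff_distrib)
      finally have "inverse (a l - a k) *s (a l - a k) *s w k \<in> N" using N(1) by (rule subspace_scale[rotated])
      moreover have "a l - a k \<noteq> 0" using inj l less.prems(3) by (auto dest: inj_onD)
      ultimately show ?thesis by simp
    next
      case False
      show ?thesis
      proof (cases "n k = 0")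
        case True
        then show ?thesis using zero less.prems(3) N(1) by (simp add: subspace_0)
      next
        case nk: False
        have "(\<Sum>j\<in>A. w j) = w k + (\<Sum>j\<in>A - {k}. w j)"
          using fin less.prems(3) by (rule sum.remove)
        also have "(\<Sum>j\<in>A - {k}. w j) = 0"
          using zero False nk by (intro sum.neutral) auto
        finally show ?thesis using less.prems(2) by simp
      qed
    qed
  qed
qed


subsection \<open>Weight spaces of graded modules\<close>

lemma foldr_opT_submodule:
  assumes "submodule d M N" "v \<in> N" "set rs \<subseteq> {1..<d}"
  shows "foldr (opT M) rs v \<in> N"
  using assms(3) by (induction rs) (use assms(1,2) in \<open>auto simp: submodule_def\<close>)

lemma jucys_murphy_submodule:
  assumes "submodule d M N" "v \<in> N" "r \<in> {1..d}"
  shows "jucys_murphy \<xi> M r v \<in> N"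
  unfolding jucys_murphy_def
  using assms by (intro subspace_scale foldr_opT_submodule) (auto simp: submodule_def)

lemma lin_map_foldr:
  assumes "\<And>r. r \<in> set rs \<Longrightarrow> lin_map V V (T r)"
  shows "lin_map V V (foldr T rs)"
  using assms by (induction rs) (simp_all add: lin_map_def)

lemma lin_map_jucys_murphy:
  assumes "hecke_module \<xi> d M" "r \<in> {1..d}"
  shows "lin_map (space M) (space M) (jucys_murphy \<xi> M r)"
proof -
  have V: "subspace (space M)" using assms(1) by (auto simp: hecke_module_def)
  have "lin_map (space M) (space M) (foldr (opT M) (rev [1..<r] @ [1..<r]))"
    using assms by (intro lin_map_foldr) (auto simp: hecke_module_def)
  from lin_mapD[OF this] V show ?thesis
    by (auto simp: lin_map_def jucys_murphy_def subspace_scale scale_right_distrib mult.commute)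
qed

lemma subspace_weight_space:
  assumes "hecke_module \<xi> d M"
  shows "subspace (weight_space \<xi> d M i)"
proof -
  have V: "subspace (space M)" using assms by (auto simp: hecke_module_def)
  have "weight_space \<xi> d M i = space M \<inter>
      (\<Inter>r\<in>{1..d}. {v \<in> space M. \<exists>n. (shifted (jucys_murphy \<xi> M r) (\<xi> ^ (i ! (r - 1))) ^^ n) v = 0})"
    by (auto simp: weight_space_def)
  then show ?thesis
    using V subspace_generalized_eigenspace[OF lin_map_jucys_murphy[OF assms] V]
    by (auto intro!: subspace_inter subspace_Int)
qed

lemma graded_moduleD:
  assumes "graded_module e \<xi> d M"
  shows "hecke_module \<xi> d M" "klr_module e d M" "bk_compatible e \<xi> d M" "graded_by_homog e d M"
  using assms by (simp_all add: graded_module_def)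

lemma subspace_space: "graded_module e \<xi> d M \<Longrightarrow> subspace (space M)"
  by (auto simp: graded_module_def hecke_module_def)

lemma lin_map_opE:
  "graded_module e \<xi> d M \<Longrightarrow> i \<in> weights e d \<Longrightarrow> lin_map (space M) (space M) (opE M i)"
  by (simp add: graded_module_def klr_module_def Let_def)

lemma sum_opE: "graded_module e \<xi> d M \<Longrightarrow> v \<in> space M \<Longrightarrow> (\<Sum>i\<in>weights e d. opE M i v) = v"
  by (simp add: graded_module_def klr_module_def Let_def)

lemma opE_in_weight_space:
  assumes "graded_module e \<xi> d M" "i \<in> weights e d" "v \<in> space M"
  shows "opE M i v \<in> weight_space \<xi> d M i"
  using graded_moduleD(3)[OF assms(1)] assms(2,3) by (auto simp: bk_compatible_def Let_def)

text \<open>Compatibility identifies the weight space with the image of \<open>opE M j\<close>,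
  where orthogonality of the KLR idempotents applies.\<close>

lemma opE_weight_space:
  assumes "graded_module e \<xi> d M" "i \<in> weights e d" "j \<in> weights e d" "v \<in> weight_space \<xi> d M j"
  shows "opE M i v = (if i = j then v else 0)"
proof -
  have "v \<in> opE M j ` space M"
    using graded_moduleD(3)[OF assms(1)] assms(3,4) unfolding bk_compatible_def Let_def by blast
  then obtain u where "u \<in> space M" "v = opE M j u" by blast
  then show ?thesis
    using graded_moduleD(2)[OF assms(1)] assms(2,3) by (simp add: klr_module_def Let_def)
qed

lemma opE_submodule:
  assumes M: "graded_module e \<xi> d M" and N: "submodule d M N"
    and prim: "primitive_root_of_unity e \<xi>" "0 < e"
    and i: "i \<in> weights e d" and v: "v \<in> N"
  shows "opE M i v \<in> N"
proof -
  note V = subspace_space[OF M] and H = graded_moduleD(1)[OF M]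
  have vV: "v \<in> space M" using N v by (auto simp: submodule_def)
  have NV: "subspace N" "N \<subseteq> space M" using N by (auto simp: submodule_def)
  \<comment> \<open>Weights agreeing with \<open>i\<close> in the first \<open>s\<close> entries.
    The sum of the idempotents over \<open>J s\<close> passes from the identity at
    \<open>s = 0\<close> to \<open>opE M i\<close> at \<open>s = d\<close>.\<close>
  define J where "J s = {j \<in> weights e d. take s j = take s i}" for s
  have finJ: "finite (J s)" for s unfolding J_def using finite_weights by simp
  have EV: "opE M j v \<in> space M" if "j \<in> weights e d" for j
    using lin_mapD(1)[OF lin_map_opE[OF M that] vV] .
  \<comment> \<open>\<open>e(i)\<close> is a product of projections onto generalized eigenspaces of single Jucys--Murphy elements.\<close>
  have "(\<Sum>j\<in>J s. opE M j v) \<in> N" if "s \<le> d" for s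
    using that
  proof (induction s)
    case 0
    then show ?case using sum_opE[OF M vV] v by (simp add: J_def)
  next
    case (Suc s)
    let ?X = "jucys_murphy \<xi> M (Suc s)"
    \<comment> \<open>Sorting by the next entry splits the partial sum into generalized eigenvectors
      of \<open>?X\<close>, one for each eigenvalue \<open>\<xi> ^ a\<close>.\<close>
    let ?w = "\<lambda>a. \<Sum>j\<in>{j \<in> J s. j ! s = a}. opE M j v"
    have X: "lin_map (space M) (space M) ?X"
      using Suc.prems by (intro lin_map_jucys_murphy[OF H]) simp
    have eig: "opE M j v \<in> {u \<in> space M. \<exists>n. (shifted ?X (\<xi> ^ (j ! s)) ^^ n) u = 0}" if "j \<in> J s" for j
      using opE_in_weight_space[OF M _ vV, of j] that Suc.prems
      by (force simp: J_def weight_space_def dest: bspec[of _ _ "Suc s"])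
    have w: "?w a \<in> {u \<in> space M. \<exists>n. (shifted ?X (\<xi> ^ a) ^^ n) u = 0}" for a
      using eig by (intro subspace_sum[OF subspace_generalized_eigenspace[OF X V]]) auto
    have i_s: "i ! s \<in> {..<e}" using weights_nth[OF i] Suc.prems by simp
    have sub: "(\<lambda>j. j ! s) ` J s \<subseteq> {..<e}"
      using weights_nth Suc.prems by (auto simp: J_def)
    have "?w (i ! s) \<in> N"
    proof (rule invariant_subspace_eigencomponents[OF X V NV, where A = "{..<e}" and a = "\<lambda>a. \<xi> ^ a"])
      show "?X u \<in> N" if "u \<in> N" for u
        using jucys_murphy_submodule[OF N that] Suc.prems by simp
      show "(\<Sum>a\<in>{..<e}. ?w a) \<in> N"
        using Suc sum.group[OF finJ finite_lessThan sub, of "\<lambda>j. opE M j v"] by simp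
    qed (use w i_s power_inj_primitive_root[OF prim] in auto)
    moreover have "{j \<in> J s. j ! s = i ! s} = J (Suc s)"
      using Suc.prems i by (auto simp: J_def weights_def take_Suc_conv_app_nth)
    ultimately show ?case by simp
  qed
  moreover have "J d = {i}" using i by (auto simp: J_def weights_def)
  ultimately show ?thesis by force
qed

section \<open>Weight spaces and degrees under quotient maps\<close>

lemma quotient_map_jucys_murphy:
  assumes N: "submodule d M N" and \<phi>: "quotient_map d M N N' L \<phi>"
    and v: "v \<in> N" and r: "r \<in> {1..d}"
  shows "\<phi> (jucys_murphy \<xi> M r v) = jucys_murphy \<xi> L r (\<phi> v)"
proof -
  have "\<phi> (foldr (opT M) rs v) = foldr (opT L) rs (\<phi> v)" if "set rs \<subseteq> {1..<d}" for rs
    using that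
  proof (induction rs)
    case (Cons a rs)
    then have "foldr (opT M) rs v \<in> N" using foldr_opT_submodule[OF N v] by simp
    then show ?case using Cons \<phi> by (simp add: quotient_map_def)
  qed simp
  moreover have set: "set (rev [1..<r] @ [1..<r]) \<subseteq> {1..<d}" using r by auto
  moreover have "lin_map N (space L) \<phi>" using \<phi> by (simp add: quotient_map_def)
  ultimately show ?thesis
    unfolding jucys_murphy_def using lin_mapD(3) foldr_opT_submodule[OF N v set] by metis
qed

text \<open>Nilpotency of the shifted Jucys-Murphy elements passes along \<open>\<phi>\<close>. The
  converse, lifting a weight vector to a weight vector, needs the idempotents and is part of
  \<open>quotient_map_dim\<close>.\<close>

lemma quotient_map_weight_space:
  assumes N: "submodule d M N" and \<phi>: "quotient_map d M N N' L \<phi>"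
    and v: "v \<in> N" "v \<in> weight_space \<xi> d M i"
  shows "\<phi> v \<in> weight_space \<xi> d L i"
proof -
  have lin: "lin_map N (space L) \<phi>" using \<phi> by (simp add: quotient_map_def)
  have subN: "subspace N" using N by (simp add: submodule_def)
  have "\<exists>n. (shifted (jucys_murphy \<xi> L r) (\<xi> ^ (i ! (r - 1))) ^^ n) (\<phi> v) = 0" if r: "r \<in> {1..d}" for r
  proof -
    let ?c = "\<xi> ^ (i ! (r - 1))"
    have *: "(shifted (jucys_murphy \<xi> M r) ?c ^^ n) v \<in> N \<and>
       \<phi> ((shifted (jucys_murphy \<xi> M r) ?c ^^ n) v) = (shifted (jucys_murphy \<xi> L r) ?c ^^ n) (\<phi> v)" for n
    proof (induction n)
      case (Suc n)
      let ?u = "(shifted (jucys_murphy \<xi> M r) ?c ^^ n) v"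
      have u: "?u \<in> N" "jucys_murphy \<xi> M r ?u \<in> N"
        using Suc jucys_murphy_submodule[OF N _ r] by auto
      then have "\<phi> (shifted (jucys_murphy \<xi> M r) ?c ?u) = shifted (jucys_murphy \<xi> L r) ?c (\<phi> ?u)"
        using lin_map_diff[OF lin subN] lin_mapD(3)[OF lin] subspace_scale[OF subN]
          quotient_map_jucys_murphy[OF N \<phi> u(1) r] by simp
      then show ?case using Suc u subN by (simp add: subspace_diff subspace_scale)
    qed (simp add: v)
    obtain n where "(shifted (jucys_murphy \<xi> M r) ?c ^^ n) v = 0"
      using v(2) r unfolding weight_space_def by blast
    then show ?thesis using *[of n] lin_map_0[OF lin subN] by auto
  qed
  moreover have "\<phi> v \<in> space L" using lin_mapD(1)[OF lin v(1)] .
  ultimately show ?thesis by (simp add: weight_space_def)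
qed

text \<open>The family concentrated in degree \<open>n\<close> with value \<open>u\<close> is
  another decomposition of \<open>u\<close>, so it coincides with \<open>g\<close>.\<close>

lemma homog_decomposition_unique:
  assumes L: "graded_module e \<xi> d L"
    and g: "finite {m. g m \<noteq> 0}" "\<And>m. g m \<in> homog L m" "(\<Sum>m | g m \<noteq> 0. g m) = u"
    and u: "u \<in> homog L n"
  shows "g n = u"
proof -
  have "\<And>m. subspace (homog L m) \<and> homog L m \<subseteq> space L"
    and ex1: "\<And>v. v \<in> space L \<Longrightarrow> \<exists>!f. finite {m. f m \<noteq> 0} \<and> (\<forall>m. f m \<in> homog L m) \<and>
        v = (\<Sum>m | f m \<noteq> 0. f m)"
    using graded_moduleD(4)[OF L] by (auto simp: graded_by_homog_def)
  then have uL: "u \<in> space L" and z: "\<And>m. 0 \<in> homog L m" using u by (auto simp: subspace_0)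
  let ?h = "\<lambda>m. if m = n then u else 0"
  have "{m. ?h m \<noteq> 0} \<subseteq> {n}" by auto
  then have fin: "finite {m. ?h m \<noteq> 0}" by (rule finite_subset) simp
  have "(\<Sum>m | ?h m \<noteq> 0. ?h m) = (\<Sum>m\<in>{n}. ?h m)"
    by (rule sum.mono_neutral_left) auto
  then have h: "finite {m. ?h m \<noteq> 0} \<and> (\<forall>m. ?h m \<in> homog L m) \<and> u = (\<Sum>m | ?h m \<noteq> 0. ?h m)"
    using fin u z by simp
  have g': "finite {m. g m \<noteq> 0} \<and> (\<forall>m. g m \<in> homog L m) \<and> u = (\<Sum>m | g m \<noteq> 0. g m)"
    using g by simp
  have "g = ?h"
    by (rule trans[OF the1_equality[OF ex1[OF uL], OF g', symmetric] the1_equality[OF ex1[OF uL], OF h]])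
  then show ?thesis by simp
qed

text \<open>Exactness in fixed weight and degree, by rank-nullity on \<open>?U\<close>. The point is
  surjectivity: a preimage in \<open>N\<close> is replaced by its component of degree
  \<open>n\<close> and then by the weight component for \<open>i\<close>, and it remains a preimage
  each time.\<close>

lemma quotient_map_dim:
  assumes M: "graded_module e \<xi> d M" and L: "graded_module e \<xi> d L"
    and prim: "primitive_root_of_unity e \<xi>" "0 < e" and i: "i \<in> weights e d"
    and N: "graded_submodule d M N" and \<phi>: "quotient_map d M N N' L \<phi>"
    and deg: "\<And>n. \<phi> ` (N \<inter> homog M n) \<subseteq> homog L (n - m)"
  shows "dim (N \<inter> weight_space \<xi> d M i \<inter> homog M n) =
    dim (N' \<inter> weight_space \<xi> d M i \<inter> homog M n) + dim (weight_space \<xi> d L i \<inter> homog L (n - m))"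
proof -
  let ?U = "N \<inter> weight_space \<xi> d M i \<inter> homog M n"
  have subm: "submodule d M N" using N by (simp add: graded_submodule_def)
  then have subN: "subspace N" "N \<subseteq> space M" by (simp_all add: submodule_def)
  have lin: "lin_map N (space L) \<phi>" and ker: "{v \<in> N. \<phi> v = 0} = N'" and surj: "\<phi> ` N = space L"
    using \<phi> by (simp_all add: quotient_map_def)
  have homM: "\<And>n. subspace (homog M n)" "\<And>n v j. v \<in> homog M n \<Longrightarrow> j \<in> weights e d \<Longrightarrow> opE M j v \<in> homog M n"
    using graded_moduleD(4)[OF M] by (simp_all add: graded_by_homog_def)
  have homL: "\<And>n. homog L n \<subseteq> space L"
    using graded_moduleD(4)[OF L] by (simp add: graded_by_homog_def)
  have U: "subspace ?U"
    using subN homM(1) subspace_weight_space[OF graded_moduleD(1)[OF M]] by (intro subspace_inter)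
  obtain F where F: "finite F" "space M = span F"
    using graded_moduleD(1)[OF M] by (auto simp: hecke_module_def)
  have "lin_map ?U (space L) \<phi>" using lin by (simp add: lin_map_def)
  then have "dim ?U = dim {v \<in> ?U. \<phi> v = 0} + dim (\<phi> ` ?U)"
    using U F subN(2) by (intro dim_kernel_image[of _ _ _ F]) auto
  moreover have "{v \<in> ?U. \<phi> v = 0} = N' \<inter> weight_space \<xi> d M i \<inter> homog M n" using ker by auto
  moreover have "\<phi> ` ?U = weight_space \<xi> d L i \<inter> homog L (n - m)"
  proof
    show "\<phi> ` ?U \<subseteq> weight_space \<xi> d L i \<inter> homog L (n - m)"
      using quotient_map_weight_space[OF subm \<phi>] deg[of n] by auto
    show "weight_space \<xi> d L i \<inter> homog L (n - m) \<subseteq> \<phi> ` ?U"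
    proof
      fix u assume u: "u \<in> weight_space \<xi> d L i \<inter> homog L (n - m)"
      then obtain v where v: "v \<in> N" "u = \<phi> v" using homL surj by blast
      obtain f where f: "finite {p. f p \<noteq> 0}" "\<And>p. f p \<in> N \<inter> homog M p" "v = (\<Sum>p | f p \<noteq> 0. f p)"
        using N v(1) unfolding graded_submodule_def by blast
      \<comment> \<open>As \<open>\<phi>\<close> lowers degrees by \<open>m\<close>, degree
        \<open>p\<close> of \<open>L\<close> receives \<open>f (p + m)\<close>. Uniqueness of
        homogeneous decompositions then makes \<open>f n\<close> alone a preimage of
        \<open>u\<close>.\<close>
      let ?g = "\<lambda>p. \<phi> (f (p + m))"
      have sub: "{p. ?g p \<noteq> 0} \<subseteq> (\<lambda>p. p - m) ` {p. f p \<noteq> 0}"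
        using lin_map_0[OF lin subN(1)] by (force intro: image_eqI[of _ _ "_ + m"])
      have "(\<Sum>p | ?g p \<noteq> 0. ?g p) = (\<Sum>p\<in>(\<lambda>p. p - m) ` {p. f p \<noteq> 0}. ?g p)"
        using f(1) sub by (intro sum.mono_neutral_left) auto
      also have "\<dots> = (\<Sum>p | f p \<noteq> 0. \<phi> (f p))"
        by (subst sum.reindex) (simp_all add: inj_on_def)
      also have "\<dots> = u"
        unfolding v(2) f(3) using f(2) by (intro lin_map_sum[OF lin subN(1), symmetric]) simp
      finally have g_sum: "(\<Sum>p | ?g p \<noteq> 0. ?g p) = u" .
      have "?g p \<in> homog L p" for p
        using deg[of "p + m"] f(2)[of "p + m"] by auto
      then have "?g (n - m) = u"
        using homog_decomposition_unique[OF L, of ?g u "n - m"] finite_subset[OF sub] f(1) g_sum u by blast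
      then have \<phi>f: "\<phi> (f n) = u" by simp
      have fN: "f n \<in> N" "f n \<in> homog M n" "f n \<in> space M" using f(2)[of n] subN(2) by auto
      have E: "opE M j (f n) \<in> N" "opE M j (f n) \<in> weight_space \<xi> d M j" if "j \<in> weights e d" for j
        using opE_submodule[OF M subm prim that fN(1)] opE_in_weight_space[OF M that fN(3)] by auto
      \<comment> \<open>Commutation of \<open>\<phi>\<close> with the idempotents is circumvented:
        each weight component of \<open>f n\<close> maps into the weight space of \<open>L\<close>
        of the same weight, and \<open>opE L i\<close> selects the one for \<open>i\<close>.\<close>
      have "u = \<phi> (\<Sum>j\<in>weights e d. opE M j (f n))" using \<phi>f sum_opE[OF M fN(3)] by simp
      also have "\<dots> = (\<Sum>j\<in>weights e d. \<phi> (opE M j (f n)))"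
        using E by (intro lin_map_sum[OF lin subN(1)])
      finally have "opE L i u = opE L i (\<Sum>j\<in>weights e d. \<phi> (opE M j (f n)))" by simp
      also have "\<dots> = (\<Sum>j\<in>weights e d. opE L i (\<phi> (opE M j (f n))))"
        using E(1) lin_mapD(1)[OF lin]
        by (intro lin_map_sum[OF lin_map_opE[OF L i] subspace_space[OF L]]) blast
      also have "\<dots> = (\<Sum>j\<in>weights e d. if i = j then \<phi> (opE M j (f n)) else 0)"
        using E quotient_map_weight_space[OF subm \<phi>]
        by (intro sum.cong refl opE_weight_space[OF L i]) auto
      also have "\<dots> = \<phi> (opE M i (f n))" using i finite_weights by simp
      finally have "u = \<phi> (opE M i (f n))" using opE_weight_space[OF L i i] u by simp
      moreover have "opE M i (f n) \<in> ?U" using E[OF i] homM(2)[OF fN(2) i] by simp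
      ultimately show "u \<in> \<phi> ` ?U" by blast
    qed
  qed
  ultimately show ?thesis by simp
qed

section \<open>Graded characters along composition series\<close>

lemma composition_series_dim:
  assumes M: "graded_module e \<xi> d M"
    and D: "\<And>\<nu>. \<nu> \<in> restricted_partitions_of e d \<Longrightarrow> graded_module e \<xi> d (D \<nu>)"
    and prim: "primitive_root_of_unity e \<xi>" "0 < e" and i: "i \<in> weights e d"
    and series: "graded_composition_series e d M D Ns fs"
  shows "dim (weight_space \<xi> d M i \<inter> homog M n) =
    (\<Sum>(\<nu>, m)\<leftarrow>fs. dim (weight_space \<xi> d (D \<nu>) i \<inter> homog (D \<nu>) (n - m)))"
proof -
  let ?W = "weight_space \<xi> d M i \<inter> homog M n"
  let ?f = "\<lambda>(\<nu>, m). dim (weight_space \<xi> d (D \<nu>) i \<inter> homog (D \<nu>) (n - m))"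
  have "dim (Ns ! k \<inter> ?W) = (\<Sum>l<k. ?f (fs ! l))" if "k \<le> length fs" for k
    using that
  proof (induction k)
    case 0
    have "subspace (weight_space \<xi> d M i)" "subspace (homog M n)"
      using subspace_weight_space[OF graded_moduleD(1)[OF M]] graded_moduleD(4)[OF M]
      by (simp_all add: graded_by_homog_def)
    then have "{0} \<inter> ?W = {0}" by (simp add: subspace_0)
    moreover have "dim {0} = 0" using dim_span_eq_card_independent[OF independent_empty] by simp
    ultimately show ?case using series by (simp add: graded_composition_series_def)
  next
    case (Suc k)
    obtain \<nu> m where fk: "fs ! k = (\<nu>, m)" by force
    have "\<forall>k<length fs. case fs ! k of (\<nu>, m) \<Rightarrow> \<nu> \<in> restricted_partitions_of e d \<and>
        (\<exists>\<phi>. quotient_map d M (Ns ! (k + 1)) (Ns ! k) (D \<nu>) \<phi> \<and>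
          (\<forall>n. \<phi> ` (Ns ! (k + 1) \<inter> homog M n) \<subseteq> homog (D \<nu>) (n - m)))"
      using series unfolding graded_composition_series_def by (elim conjE)
    then obtain \<phi> where \<nu>: "\<nu> \<in> restricted_partitions_of e d"
      and \<phi>: "quotient_map d M (Ns ! Suc k) (Ns ! k) (D \<nu>) \<phi>"
      and deg: "\<And>n. \<phi> ` (Ns ! Suc k \<inter> homog M n) \<subseteq> homog (D \<nu>) (n - m)"
      using Suc.prems fk by (auto dest!: spec[of _ k])
    have "Ns ! Suc k \<in> set Ns" using series Suc.prems by (simp add: graded_composition_series_def)
    then have "graded_submodule d M (Ns ! Suc k)" using series by (simp add: graded_composition_series_def)
    from quotient_map_dim[OF M D[OF \<nu>] prim i this \<phi> deg, of n] Suc fk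
    show ?case by (simp add: Int_assoc)
  qed
  from this[of "length fs"] have "dim (space M \<inter> ?W) = (\<Sum>l<length fs. ?f (fs ! l))"
    using series by (simp add: graded_composition_series_def)
  moreover have "space M \<inter> ?W = ?W" by (auto simp: weight_space_def)
  ultimately show ?thesis by (simp add: sum_list_sum_nth atLeast0LessThan)
qed

text \<open>Enlarging the range of summation to a finite superset of the support lets a Specht
  module and its shifted factors be summed over one common set of degrees.\<close>

lemma qdim_eq:
  assumes "finite F" "\<And>n. n \<notin> F \<Longrightarrow> W \<inter> homog M n = {0}"
  shows "qdim M W = (\<Sum>n\<in>F. of_nat (dim (W \<inter> homog M n)) * qv powi n)"
  unfolding qdim_def
proof (rule sum.mono_neutral_left[OF assms(1)])
  show "{m. W \<inter> homog M m \<noteq> {0}} \<subseteq> F" using assms(2) by auto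
  have "dim {0} = 0" using dim_span_eq_card_independent[OF independent_empty] by simp
  then show "\<forall>n\<in>F - {m. W \<inter> homog M m \<noteq> {0}}. of_nat (dim (W \<inter> homog M n)) * qv powi n = 0"
    by simp
qed

lemma weight_homog_eq_0:
  assumes M: "graded_module e \<xi> d M" and "dim (weight_space \<xi> d M i \<inter> homog M n) = 0"
  shows "weight_space \<xi> d M i \<inter> homog M n = {0}"
proof -
  have "subspace (weight_space \<xi> d M i)" "subspace (homog M n)"
    using subspace_weight_space[OF graded_moduleD(1)[OF M]] graded_moduleD(4)[OF M]
    by (simp_all add: graded_by_homog_def)
  then have "0 \<in> weight_space \<xi> d M i \<inter> homog M n" by (simp add: subspace_0)
  moreover obtain F where F: "finite F" "space M = span F"
    using graded_moduleD(1)[OF M] by (auto simp: hecke_module_def)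
  moreover have "weight_space \<xi> d M i \<inter> homog M n \<subseteq> space M" by (auto simp: weight_space_def)
  ultimately show ?thesis using dim_eq_0_subset[OF F(1) _ assms(2)] by auto
qed

text \<open>A vector of degree \<open>n\<close> is a combination of the \<open>v_T\<close> with
  \<open>deg T = n\<close>; \<open>opE M i\<close> kills those of a different residue sequence and
  fixes the rest, so a vector of weight \<open>i\<close> involves only the latter.\<close>

lemma specht_dim:
  assumes "graded_specht e \<xi> d \<mu> M" and \<mu>: "\<mu> \<in> partitions_of d" and i: "i \<in> weights e d" and "0 < e"
  shows "dim (weight_space \<xi> d M i \<inter> homog M n) =
    card {ts \<in> standard_tableaux \<mu>. res_seq e ts = i \<and> tab_deg e ts = n}"
proof -
  have M: "graded_module e \<xi> d M" using assms(1) by (simp add: graded_specht_def)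
  let ?ST = "standard_tableaux \<mu>"
  let ?T = "{ts \<in> ?ST. res_seq e ts = i \<and> tab_deg e ts = n}"
  obtain v where inj: "inj_on v ?ST" and ind: "independent (v ` ?ST)" and sp: "span (v ` ?ST) = space M"
    and wt: "\<And>ts. ts \<in> ?ST \<Longrightarrow> v ts \<in> weight_space \<xi> d M (res_seq e ts)"
    and hom: "homog M n = span (v ` {ts \<in> ?ST. tab_deg e ts = n})"
    using assms(1) by (auto simp: graded_specht_def Let_def)
  have res: "res_seq e ts \<in> weights e d" if "ts \<in> ?ST" for ts
  proof -
    have "length ts = d" using that \<mu> by (auto simp: standard_tableaux_def partitions_of_def distinct_card)
    then show ?thesis using res_less[OF \<open>0 < e\<close>] by (auto simp: weights_def res_seq_def)
  qed
  note lin = lin_map_opE[OF M i]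
  have "weight_space \<xi> d M i \<inter> homog M n = span (v ` ?T)"
  proof
    show "span (v ` ?T) \<subseteq> weight_space \<xi> d M i \<inter> homog M n"
    proof (rule span_minimal)
      show "v ` ?T \<subseteq> weight_space \<xi> d M i \<inter> homog M n"
        unfolding hom using wt by (auto intro!: span_base)
      show "subspace (weight_space \<xi> d M i \<inter> homog M n)"
        unfolding hom by (intro subspace_inter subspace_weight_space[OF graded_moduleD(1)[OF M]] subspace_span)
    qed
    show "weight_space \<xi> d M i \<inter> homog M n \<subseteq> span (v ` ?T)"
    proof
      fix x assume x: "x \<in> weight_space \<xi> d M i \<inter> homog M n"
      have "x \<in> span (v ` {ts \<in> ?ST. tab_deg e ts = n})" using x hom by simp
      then have "x \<in> space M \<and> opE M i x \<in> span (v ` ?T)"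
      proof (induction rule: span_induct_alt)
        case base
        then show ?case
          using lin_map_0[OF lin subspace_space[OF M]] subspace_space[OF M] by (simp add: span_zero subspace_0)
      next
        case (step c y z)
        then obtain ts where ts: "ts \<in> ?ST" "tab_deg e ts = n" "y = v ts" by auto
        have y: "y \<in> space M" using wt[OF ts(1)] ts(3) by (simp add: weight_space_def)
        have "opE M i y = (if i = res_seq e ts then y else 0)"
          using opE_weight_space[OF M i res[OF ts(1)]] wt[OF ts(1)] ts(3) by simp
        then have "opE M i y \<in> span (v ` ?T)" using ts by (auto intro: span_base span_zero)
        then show ?case
          using step y subspace_space[OF M] lin_mapD(2,3)[OF lin]
          by (simp add: subspace_add subspace_scale span_add span_scale)
      qed
      then show "x \<in> span (v ` ?T)" using opE_weight_space[OF M i i] x by simp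
    qed
  qed
  moreover have "independent (v ` ?T)" by (rule independent_mono[OF ind]) auto
  moreover have "card (v ` ?T) = card ?T" by (rule card_image[OF inj_on_subset[OF inj]]) auto
  ultimately show ?thesis by (simp add: dim_eq_card_independent)
qed

lemma specht_weight_eq_0:
  assumes "graded_specht e \<xi> d \<mu> M" "\<mu> \<in> partitions_of d" "i \<in> weights e d" "0 < e"
    and "n \<notin> tab_deg e ` standard_tableaux \<mu>"
  shows "dim (weight_space \<xi> d M i \<inter> homog M n) = 0"
proof -
  have empty: "{ts \<in> standard_tableaux \<mu>. res_seq e ts = i \<and> tab_deg e ts = n} = {}"
    using assms(5) by auto
  show ?thesis unfolding specht_dim[OF assms(1-4)] empty by simp
qed

lemma ch_q_specht:
  assumes S: "graded_specht e \<xi> d \<mu> M" and \<mu>: "\<mu> \<in> partitions_of d" and i: "i \<in> weights e d" and "0 < e"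
  shows "ch_q \<xi> d M i = (\<Sum>ts | ts \<in> standard_tableaux \<mu> \<and> res_seq e ts = i. qv powi tab_deg e ts)"
proof -
  have M: "graded_module e \<xi> d M" using S by (simp add: graded_specht_def)
  let ?T = "{ts. ts \<in> standard_tableaux \<mu> \<and> res_seq e ts = i}"
  let ?F = "tab_deg e ` standard_tableaux \<mu>"
  have fin: "finite ?F" "finite ?T" using finite_standard_tableaux[of \<mu>] by simp_all
  have "ch_q \<xi> d M i = (\<Sum>n\<in>?F. of_nat (dim (weight_space \<xi> d M i \<inter> homog M n)) * qv powi n)"
    unfolding ch_q_def
    by (intro qdim_eq fin weight_homog_eq_0[OF M] specht_weight_eq_0[OF assms])
  also have "\<dots> = (\<Sum>n\<in>?F. \<Sum>ts\<in>{ts \<in> ?T. tab_deg e ts = n}. qv powi tab_deg e ts)"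
    by (intro sum.cong refl) (simp add: specht_dim[OF assms] conj_assoc)
  also have "\<dots> = (\<Sum>ts\<in>?T. qv powi tab_deg e ts)"
    using fin by (intro sum.group) auto
  finally show ?thesis .
qed

lemma ch_q_decomposition:
  assumes S: "graded_specht e \<xi> d \<mu> (S \<mu>)" and \<mu>: "\<mu> \<in> partitions_of d"
    and D: "\<And>\<nu>. \<nu> \<in> restricted_partitions_of e d \<Longrightarrow> graded_module e \<xi> d (D \<nu>)"
    and prim: "primitive_root_of_unity e \<xi>" "0 < e" and i: "i \<in> weights e d"
    and dec: "is_graded_decomposition_matrix e d S D dec"
  shows "ch_q \<xi> d (S \<mu>) i = (\<Sum>\<nu>\<in>restricted_partitions_of e d. dec \<mu> \<nu> * ch_q \<xi> d (D \<nu>) i)"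
proof -
  have M: "graded_module e \<xi> d (S \<mu>)" using S by (simp add: graded_specht_def)
  let ?R = "restricted_partitions_of e d"
  let ?F = "tab_deg e ` standard_tableaux \<mu>"
  let ?dim = "\<lambda>M n. dim (weight_space \<xi> d M i \<inter> homog M n)"
  have finF: "finite ?F" using finite_standard_tableaux by simp
  obtain Ns fs where series: "graded_composition_series e d (S \<mu>) D Ns fs"
    and dec_eq: "\<And>\<nu>. \<nu> \<in> ?R \<Longrightarrow> dec \<mu> \<nu> = (\<Sum>(\<nu>', m)\<leftarrow>fs. if \<nu>' = \<nu> then qv powi m else 0)"
    using dec \<mu> unfolding is_graded_decomposition_matrix_def by blast
  have fs: "\<nu> \<in> ?R" if "(\<nu>, m) \<in> set fs" for \<nu> m
    using series that unfolding graded_composition_series_def in_set_conv_nth by force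
  note dim_eq = composition_series_dim[OF M D prim i series]
  have factor: "(\<Sum>n\<in>?F. of_nat (?dim (D \<nu>) (n - m)) * qv powi n) = qv powi m * ch_q \<xi> d (D \<nu>) i"
    if \<nu>m: "(\<nu>, m) \<in> set fs" for \<nu> m
  proof -
    \<comment> \<open>Dimensions are natural numbers and cannot cancel, so a degree missing from
      \<open>S \<mu>\<close> is missing from every shifted factor.\<close>
    have "?dim (D \<nu>) p = 0" if "p \<notin> (\<lambda>n. n - m) ` ?F" for p
    proof -
      have "p + m \<notin> ?F" using that by (metis add_diff_cancel image_eqI)
      then have "?dim (S \<mu>) (p + m) = 0" by (rule specht_weight_eq_0[OF S \<mu> i prim(2)])
      then have "\<forall>(\<nu>', m')\<in>set fs. ?dim (D \<nu>') (p + m - m') = 0"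
        by (simp add: dim_eq sum_list_eq_0_iff case_prod_beta)
      then show ?thesis using \<nu>m by fastforce
    qed
    then have "ch_q \<xi> d (D \<nu>) i = (\<Sum>p\<in>(\<lambda>n. n - m) ` ?F. of_nat (?dim (D \<nu>) p) * qv powi p)"
      unfolding ch_q_def using finF by (intro qdim_eq weight_homog_eq_0[OF D[OF fs[OF \<nu>m]]]) auto
    also have "\<dots> = (\<Sum>n\<in>?F. of_nat (?dim (D \<nu>) (n - m)) * qv powi (n - m))"
      by (subst sum.reindex) (simp_all add: inj_on_def)
    finally have ch: "ch_q \<xi> d (D \<nu>) i = \<dots>" .
    have "x * qv powi n = qv powi m * (x * qv powi (n - m))" for x n
      using power_int_add[of qv m "n - m"] by simp
    then show ?thesis unfolding ch sum_distrib_left by (intro sum.cong refl)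
  qed
  have "ch_q \<xi> d (S \<mu>) i = (\<Sum>n\<in>?F. of_nat (?dim (S \<mu>) n) * qv powi n)"
    unfolding ch_q_def
    by (intro qdim_eq finF weight_homog_eq_0[OF M] specht_weight_eq_0[OF S \<mu> i prim(2)])
  also have "\<dots> = (\<Sum>n\<in>?F. \<Sum>l<length fs. case fs ! l of (\<nu>, m) \<Rightarrow> of_nat (?dim (D \<nu>) (n - m)) * qv powi n)"
    by (simp add: dim_eq sum_list_sum_nth atLeast0LessThan sum_distrib_right case_prod_beta)
  also have "\<dots> = (\<Sum>l<length fs. \<Sum>n\<in>?F. case fs ! l of (\<nu>, m) \<Rightarrow> of_nat (?dim (D \<nu>) (n - m)) * qv powi n)"
    by (rule sum.swap)
  also have "\<dots> = (\<Sum>l<length fs. case fs ! l of (\<nu>, m) \<Rightarrow> qv powi m * ch_q \<xi> d (D \<nu>) i)"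
  proof (rule sum.cong[OF refl])
    fix l assume "l \<in> {..<length fs}"
    then have "fs ! l \<in> set fs" by simp
    moreover obtain \<nu> m where "fs ! l = (\<nu>, m)" by (cases "fs ! l")
    ultimately show "(\<Sum>n\<in>?F. case fs ! l of (\<nu>, m) \<Rightarrow> of_nat (?dim (D \<nu>) (n - m)) * qv powi n) =
        (case fs ! l of (\<nu>, m) \<Rightarrow> qv powi m * ch_q \<xi> d (D \<nu>) i)"
      using factor by simp
  qed
  \<comment> \<open>Exactly one \<open>\<nu>\<close> matches each factor, since the labels in a
    composition series are restricted; swapping the sums then collects the decomposition
    numbers.\<close>
  also have "\<dots> = (\<Sum>l<length fs. \<Sum>\<nu>\<in>?R. (case fs ! l of (\<nu>', m) \<Rightarrow> if \<nu>' = \<nu> then qv powi m else 0) * ch_q \<xi> d (D \<nu>) i)"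
  proof (rule sum.cong[OF refl])
    fix l assume "l \<in> {..<length fs}"
    then have "fs ! l \<in> set fs" by simp
    moreover obtain \<nu>' m where l: "fs ! l = (\<nu>', m)" by (cases "fs ! l")
    ultimately have "\<nu>' \<in> ?R" using fs by simp
    then show "(case fs ! l of (\<nu>, m) \<Rightarrow> qv powi m * ch_q \<xi> d (D \<nu>) i) =
        (\<Sum>\<nu>\<in>?R. (case fs ! l of (\<nu>', m) \<Rightarrow> if \<nu>' = \<nu> then qv powi m else 0) * ch_q \<xi> d (D \<nu>) i)"
      using finite_restricted_partitions_of by (simp add: l if_distrib[of "\<lambda>x. x * _"] cong: if_cong)
  qed
  also have "\<dots> = (\<Sum>\<nu>\<in>?R. \<Sum>l<length fs. (case fs ! l of (\<nu>', m) \<Rightarrow> if \<nu>' = \<nu> then qv powi m else 0) * ch_q \<xi> d (D \<nu>) i)"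
    by (rule sum.swap)
  also have "\<dots> = (\<Sum>\<nu>\<in>?R. dec \<mu> \<nu> * ch_q \<xi> d (D \<nu>) i)"
    by (intro sum.cong refl) (simp add: dec_eq sum_list_sum_nth atLeast0LessThan sum_distrib_right)
  finally show ?thesis .
qed

end


section \<open>The coefficients of the first approximation\<close>

lemma restricted_partitions_subset: "restricted_partitions_of e d \<subseteq> partitions_of d"
  by (auto simp: restricted_partitions_of_def)

theorem mainTheorem10:
  fixes scale :: "'k::{alg_closed_field, field_char_0} \<Rightarrow> 'v::ab_group_add \<Rightarrow> 'v"
    and \<xi> :: 'k
    and e d :: nat
    and S D :: "diagram \<Rightarrow> 'v hmod"
    and dec :: "diagram \<Rightarrow> diagram \<Rightarrow> ratfun"
    and bar :: "fock \<Rightarrow> fock"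
    and G :: "diagram \<Rightarrow> fock"
    and b :: "diagram \<Rightarrow> diagram \<Rightarrow> ratfun"
  assumes "vector_space scale"
    and "e \<ge> 2"
    and "primitive_root_of_unity e \<xi>"
    and specht: "\<forall>\<mu>\<in>partitions_of d. ambient_space.graded_specht scale e \<xi> d \<mu> (S \<mu>)"
    and irred: "\<forall>\<nu>\<in>restricted_partitions_of e d.
                  ambient_space.graded_irreducible scale e \<xi> d (S \<nu>) (D \<nu>)"
    and dec: "ambient_space.is_graded_decomposition_matrix scale e d S D dec"
    and bar: "is_bar_involution e bar"
    and canonical: "\<forall>\<nu>\<in>restricted_partitions_of e d. is_canonical_basis_element e bar \<nu> (G \<nu>)"
    and graded_ariki: "\<forall>\<nu>\<in>restricted_partitions_of e d.
                         G \<nu> = (\<Sum>\<mu>\<in>partitions_of d. fscale (dec \<mu> \<nu>) (fbasis \<mu>))"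
    and expansion: "\<forall>\<kappa>\<in>restricted_partitions_of e d.
                      fscale (r_factor e \<kappa>) (LLT_approx e \<kappa>) =
                        (\<Sum>\<nu>\<in>restricted_partitions_of e d. fscale (b \<kappa> \<nu>) (G \<nu>))"
  shows "\<forall>\<kappa>\<in>restricted_partitions_of e d. \<forall>\<nu>\<in>restricted_partitions_of e d.
           b \<kappa> \<nu> = ambient_space.ladder_mult scale e \<xi> d \<kappa> (D \<nu>)"
proof (intro ballI)
  fix \<kappa> \<nu>\<^sub>0
  assume \<kappa>: "\<kappa> \<in> restricted_partitions_of e d" and \<nu>\<^sub>0: "\<nu>\<^sub>0 \<in> restricted_partitions_of e d"
  interpret vector_space scale by fact
  interpret ambient_space scale ..
  let ?R = "restricted_partitions_of e d"
  let ?m = "\<lambda>\<nu>. ladder_mult e \<xi> d \<kappa> (D \<nu>)"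
  have e: "0 < e" using \<open>e \<ge> 2\<close> by simp
  have D: "graded_module e \<xi> d (D \<nu>)" if "\<nu> \<in> ?R" for \<nu>
    using irred that by (simp add: graded_irreducible_def)
  have \<kappa>P: "\<kappa> \<in> partitions_of d" "is_diagram \<kappa>"
    using \<kappa> restricted_partitions_subset by (auto simp: partitions_of_def)
  have j: "ladder_weight e \<kappa> \<in> weights e d" by (rule ladder_weight_in_weights[OF e \<kappa>P(1)])
  \<comment> \<open>Here the graded form of Ariki's theorem links the Fock space with the module
    category.\<close>
  have lookup_G: "Poly_Mapping.lookup (G \<nu>) \<mu> = dec \<mu> \<nu>" if "\<nu> \<in> ?R" "\<mu> \<in> partitions_of d" for \<mu> \<nu>
    using graded_ariki that finite_partitions_of
    by (simp add: lookup_sum lookup_fbasis if_distrib[of "(*) _"] cong: if_cong)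
  have eq: "(\<Sum>\<nu>\<in>?R. (b \<kappa> \<nu> - ?m \<nu>) * dec \<mu> \<nu>) = 0" if \<mu>: "\<mu> \<in> partitions_of d" for \<mu>
  proof -
    have S: "graded_specht e \<xi> d \<mu> (S \<mu>)" using specht \<mu> by blast
    have "is_diagram \<mu>" using \<mu> by (simp add: partitions_of_def)
    have "(\<Sum>\<nu>\<in>?R. b \<kappa> \<nu> * dec \<mu> \<nu>) =
        Poly_Mapping.lookup (fscale (r_factor e \<kappa>) (LLT_approx e \<kappa>)) \<mu>"
      unfolding expansion[rule_format, OF \<kappa>] by (simp add: lookup_sum lookup_G \<mu>)
    also have "\<dots> = (\<Sum>ts | ts \<in> standard_tableaux \<mu> \<and> res_seq e ts = ladder_weight e \<kappa>. qv powi tab_deg e ts)"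
      unfolding r_factor_LLT_approx[OF e \<kappa>P(2)] by (rule foldl_f_op_vacuum(2)[OF \<open>is_diagram \<mu>\<close>])
    also have "\<dots> = ch_q \<xi> d (S \<mu>) (ladder_weight e \<kappa>)"
      by (rule ch_q_specht[OF S \<mu> j e, symmetric])
    also have "\<dots> = (\<Sum>\<nu>\<in>?R. dec \<mu> \<nu> * ?m \<nu>)"
      unfolding ladder_mult_def
      by (rule ch_q_decomposition[OF S \<mu> D \<open>primitive_root_of_unity e \<xi>\<close> e j dec])
    finally show ?thesis by (simp add: left_diff_distrib sum_subtractf mult.commute[of "dec \<mu> _"])
  qed
  \<comment> \<open>Keeping the equations at restricted \<open>\<mu>\<close> gives a square system;
    the normalization of the canonical basis makes its matrix the identity modulo
    \<open>q\<close>.\<close>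
  have "b \<kappa> \<nu>\<^sub>0 - ?m \<nu>\<^sub>0 = 0"
  proof (rule unitriangular_mod_q_independent[OF finite_restricted_partitions_of, where M = dec])
    show "dec \<mu> \<nu> - (if \<mu> = \<nu> then 1 else 0) \<in> q_poly_ideal" if "\<mu> \<in> ?R" "\<nu> \<in> ?R" for \<mu> \<nu>
    proof -
      have "Poly_Mapping.lookup (G \<nu> - fbasis \<nu>) \<mu> \<in> q_poly_ideal"
        using canonical that by (simp add: is_canonical_basis_element_def)
      moreover have "Poly_Mapping.lookup (G \<nu> - fbasis \<nu>) \<mu> = dec \<mu> \<nu> - (if \<mu> = \<nu> then 1 else 0)"
        using that restricted_partitions_subset
        by (auto simp: lookup_minus lookup_fbasis lookup_G subset_iff)
      ultimately show ?thesis by simp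
    qed
  qed (use eq restricted_partitions_subset \<nu>\<^sub>0 in auto)
  then show "b \<kappa> \<nu>\<^sub>0 = ?m \<nu>\<^sub>0" by simp
qed

end
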